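(* Let $k$ be a field and $H$ a weak Hopf algebra over $k$ with antipode $S$. Then $(H^LH^R,\sqcap^L,\sqcap^L)$ is a Rota-Baxter paired $H$-comodule of weight $-1$, whose comodule structure map is given by the comultiplication $\Delta$ of $H$. In particular, $(H^LH^R,\sqcap^L)$ is a Rota-Baxter coalgebra of weight $-1$.
   Context: All spaces, maps and tensor products are over $k$; $\Delta(h)=h_1\otimes h_2$ (Sweedler notation). A weak bialgebra is a (unital) algebra and (counital) coalgebra $H$ such that: (1) $\Delta(xy)=\Delta(x)\Delta(y)$; (2) $\varepsilon(xyz)=\varepsilon(xy_1)\varepsilon(y_2z)=\varepsilon(xy_2)\varepsilon(y_1z)$ for all $x,y,z\in H$; (3) $(\Delta\otimes\mathrm{id})\Delta(1)=(\Delta(1)\otimes1)(1\otimes\Delta(1))=(1\otimes\Delta(1))(\Delta(1)\otimes1)$. Write $\Delta(1)=1_1\otimes1_2$. A weak Hopf algebra is a weak bialgebra with a linear map $S:H\to H$ (antipode) such that $h_1S(h_2)=\varepsilon(1_1h)1_2$, $S(h_1)h_2=\varepsilon(h1_2)1_1$, $S(h_1)h_2S(h_3)=S(h)$ for all $h\in H$. Define $\sqcap^L,\sqcap^R:H\to H$ by $\sqcap^L(h)=\varepsilon(1_1h)1_2$ and $\sqcap^R(h)=\varepsilon(h1_2)1_1$, and let $H^L=\sqcap^L(H)$, $H^R=\sqcap^R(H)$. $H^LH^R$ is the span of the products $xy$, $x\in H^L$, $y\in H^R$; it is a subcoalgebra of $H$, regarded as a left $H$-comodule via $\Delta$. For a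 left $C$-comodule $M$ with coaction $\rho$ and linear maps $P:C\to C$, $T:M\to M$, the triple $(M,P,T)$ is a Rota-Baxter paired (left) $C$-comodule of weight $\lambda\in k$ if $(P\otimes T)\rho=(P\otimes \mathrm{id})\rho T+(\mathrm{id}\otimes T)\rho T+\lambda\rho T$. A coalgebra $C$ with a linear map $P:C\to C$ is a Rota-Baxter coalgebra of weight $\lambda$ if $(P\otimes P)\Delta=(P\otimes \mathrm{id})\Delta P+(\mathrm{id}\otimes P)\Delta P+\lambda\Delta P$. In the statement, the first $\sqcap^L$ in the triple is the operator on $H$, and the operator on $H^LH^R$ is the restriction of $\sqcap^L$. *)

theory Defs
  imports Complex_Main "HOL-Library.Function_Algebras"
begin

section \<open>Tensor products of vector spaces\<close>

text \<open>
  A vector space over the field \<open>'k\<close> is a subspace \<open>V\<close> of a type with scalar multiplication \<open>s\<close>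
  satisfying the library's \<^locale>\<open>vector_space\<close>. Carriers are explicit since the subcoalgebra
  \<open>H\<^sup>L H\<^sup>R\<close> depends on terms.

  The pure tensor \<open>x \<otimes> y\<close> is modelled as evaluation at \<open>(x, y)\<close> on bilinear forms, with
  the value 0 at functions that are not bilinear forms, and \<open>V \<otimes> W\<close> is the span of the pure
  tensors. Over a field this is a tensor product: see the lemma \<open>tensor_universal_property\<close>.
  For subspaces \<open>V\<close> and \<open>W\<close>, \<open>V \<otimes> W\<close> is literally a subspace of the ambient tensor product.
\<close>

type_synonym ('k, 'a, 'b) tensor = "('a \<Rightarrow> 'b \<Rightarrow> 'k) \<Rightarrow> 'k"

definition linear_on :: "('k::field \<Rightarrow> 'a::ab_group_add \<Rightarrow> 'a) \<Rightarrow> ('k \<Rightarrow> 'b::ab_group_add \<Rightarrow> 'b) \<Rightarrow>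
    'a set \<Rightarrow> 'b set \<Rightarrow> ('a \<Rightarrow> 'b) \<Rightarrow> bool" where
  "linear_on s1 s2 V W f \<longleftrightarrow> f ` V \<subseteq> W \<and>
     (\<forall>x\<in>V. \<forall>y\<in>V. f (x + y) = f x + f y) \<and> (\<forall>c. \<forall>x\<in>V. f (s1 c x) = s2 c (f x))"

definition bilinear_on :: "('k::field \<Rightarrow> 'a::ab_group_add \<Rightarrow> 'a) \<Rightarrow> ('k \<Rightarrow> 'b::ab_group_add \<Rightarrow> 'b) \<Rightarrow>
    ('k \<Rightarrow> 'c::ab_group_add \<Rightarrow> 'c) \<Rightarrow> 'a set \<Rightarrow> 'b set \<Rightarrow> ('a \<Rightarrow> 'b \<Rightarrow> 'c) \<Rightarrow> bool" where
  "bilinear_on s1 s2 s3 V W f \<longleftrightarrow>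
     (\<forall>y\<in>W. linear_on s1 s3 V UNIV (\<lambda>x. f x y)) \<and> (\<forall>x\<in>V. linear_on s2 s3 W UNIV (f x))"

definition tensor :: "('k::field \<Rightarrow> 'a::ab_group_add \<Rightarrow> 'a) \<Rightarrow> ('k \<Rightarrow> 'b::ab_group_add \<Rightarrow> 'b) \<Rightarrow>
    'a \<Rightarrow> 'b \<Rightarrow> ('k, 'a, 'b) tensor" where
  "tensor s1 s2 x y = (\<lambda>\<beta>. if bilinear_on s1 s2 (*) UNIV UNIV \<beta> then \<beta> x y else 0)"

definition tensor_scale :: "'k::field \<Rightarrow> ('k, 'a, 'b) tensor \<Rightarrow> ('k, 'a, 'b) tensor" where
  "tensor_scale c t = (\<lambda>\<beta>. c * t \<beta>)"

definition tensor_space :: "('k::field \<Rightarrow> 'a::ab_group_add \<Rightarrow> 'a) \<Rightarrow> ('k \<Rightarrow> 'b::ab_group_add \<Rightarrow> 'b) \<Rightarrow>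
    'a set \<Rightarrow> 'b set \<Rightarrow> ('k, 'a, 'b) tensor set" where
  "tensor_space s1 s2 V W =
     module.span tensor_scale {tensor s1 s2 x y | x y. x \<in> V \<and> y \<in> W}"

text \<open>
  The linear map induced on \<open>V \<otimes> W\<close> by a bilinear map \<open>f\<close> on \<open>V \<times> W\<close>: write \<open>t\<close> as a finite sum
  of pure tensors \<open>x\<^sub>i \<otimes> y\<^sub>i\<close> and return the sum of the \<open>f x\<^sub>i y\<^sub>i\<close>. For \<open>f\<close> bilinear this
  does not depend on the chosen expression (lemma \<open>tensor_lift_sum\<close>). Sweedler notation is read this
  way: an expression \<open>f h\<^sub>1 h\<^sub>2\<close> is \<open>tensor_lift s s V W f (\<Delta> h)\<close>.
\<close>

definition tensor_lift :: "('k::field \<Rightarrow> 'a::ab_group_add \<Rightarrow> 'a) \<Rightarrow> ('k \<Rightarrow> 'b::ab_group_add \<Rightarrow> 'b) \<Rightarrow>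
    'a set \<Rightarrow> 'b set \<Rightarrow> ('a \<Rightarrow> 'b \<Rightarrow> 'c::ab_group_add) \<Rightarrow> ('k, 'a, 'b) tensor \<Rightarrow> 'c" where
  "tensor_lift s1 s2 V W f t =
     (let ps = (SOME ps. set ps \<subseteq> V \<times> W \<and> t = (\<Sum>(x, y)\<leftarrow>ps. tensor s1 s2 x y))
      in \<Sum>(x, y)\<leftarrow>ps. f x y)"

lemma vector_space_tensor_scale: "vector_space tensor_scale"
  by unfold_locales (auto simp: tensor_scale_def algebra_simps fun_eq_iff)

lemma bilinear_on_tensor:
  assumes "vector_space s1" "vector_space s2"
  shows "bilinear_on s1 s2 tensor_scale V W (tensor s1 s2)"
  by (auto simp: bilinear_on_def linear_on_def tensor_def tensor_scale_def fun_eq_iff)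

lemma bilinear_on_scale_left:
  "bilinear_on s1 s2 s3 V W f \<Longrightarrow> x \<in> V \<Longrightarrow> y \<in> W \<Longrightarrow> f (s1 c x) y = s3 c (f x y)"
  by (simp add: bilinear_on_def linear_on_def)

lemma tensor_space_sum_list:
  assumes "vector_space s1" "vector_space s2" "module.subspace s1 V" "t \<in> tensor_space s1 s2 V W"
  shows "\<exists>ps. set ps \<subseteq> V \<times> W \<and> t = (\<Sum>(x, y)\<leftarrow>ps. tensor s1 s2 x y)"
proof -
  interpret T: vector_space "tensor_scale :: 'a \<Rightarrow> ('a,'b,'c) tensor \<Rightarrow> _"
    by (rule vector_space_tensor_scale)
  interpret V1: vector_space s1 by fact
  show ?thesis using assms(4) unfolding tensor_space_def
  proof (induction rule: T.span_induct_alt)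
    case base
    show ?case by (rule exI[of _ "[]"]) simp
  next
    case (step c x t)
    then obtain ps u v where ps: "set ps \<subseteq> V \<times> W" "t = (\<Sum>(x, y)\<leftarrow>ps. tensor s1 s2 x y)"
      and uv: "x = tensor s1 s2 u v" "u \<in> V" "v \<in> W" by auto
    have "tensor_scale c x = tensor s1 s2 (s1 c u) v"
      using bilinear_on_scale_left[OF bilinear_on_tensor[OF assms(1,2)], of u UNIV v UNIV c] uv by simp
    then show ?case using ps uv V1.subspace_scale[OF assms(3)]
      by (intro exI[of _ "(s1 c u, v) # ps"]) auto
  qed
qed

lemma linear_on_compose_linear:
  assumes "linear_on s1 s2 V UNIV f" "Vector_Spaces.linear s2 s3 g" "Vector_Spaces.linear s0 s1 p" "range p \<subseteq> V"
  shows "linear_on s0 s3 UNIV UNIV (\<lambda>x. g (f (p x)))"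
proof -
  interpret g: Vector_Spaces.linear s2 s3 g by fact
  interpret p: Vector_Spaces.linear s0 s1 p by fact
  show ?thesis using assms(1,4)
    by (auto simp: linear_on_def p.add p.scale g.add g.scale image_subset_iff)
qed

lemma subspace_projection:
  assumes "vector_space s" "module.subspace s V"
  shows "\<exists>p. Vector_Spaces.linear s s p \<and> range p \<subseteq> V \<and> (\<forall>x\<in>V. p x = x)"
proof -
  interpret vector_space s by fact
  interpret P: vector_space_pair s s by unfold_locales
  show ?thesis
    using P.linear_exists_left_inverse_on[OF linear_id assms(2)] by (auto simp: id_def)
qed

lemma separating_functional:
  assumes "vector_space s" "d \<noteq> 0"
  shows "\<exists>\<phi>. Vector_Spaces.linear s (*) \<phi> \<and> \<phi> d \<noteq> 0"
proof -
  interpret vector_space s by fact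
  interpret K: vector_space "(*) :: 'a \<Rightarrow> 'a \<Rightarrow> 'a" by unfold_locales (auto simp: algebra_simps)
  interpret P: vector_space_pair s "(*) :: 'a \<Rightarrow> 'a \<Rightarrow> 'a" by unfold_locales
  have "independent {d}" using assms(2) by simp
  from P.linear_independent_extend[OF this, of "\<lambda>_. 1"] show ?thesis by auto
qed

lemma linear_sum_list:
  assumes "Vector_Spaces.linear s1 s2 g"
  shows "g (sum_list xs) = (\<Sum>x\<leftarrow>xs. g x)"
proof -
  interpret g: Vector_Spaces.linear s1 s2 g by fact
  show ?thesis by (induction xs) (auto simp: g.add g.zero)
qed

lemma bilinear_sum_eq:
  assumes vs: "vector_space s1" "vector_space s2" "vector_space s3"
    and VW: "module.subspace s1 V" "module.subspace s2 W"
    and f: "bilinear_on s1 s2 s3 V W f"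
    and ps: "set ps \<subseteq> V \<times> W" and qs: "set qs \<subseteq> V \<times> W"
    and eq: "(\<Sum>(x, y)\<leftarrow>ps. tensor s1 s2 x y) = (\<Sum>(x, y)\<leftarrow>qs. tensor s1 s2 x y)"
  shows "(\<Sum>(x, y)\<leftarrow>ps. f x y) = (\<Sum>(x, y)\<leftarrow>qs. f x y)" (is "?a = ?b")
proof (rule ccontr)
  assume "?a \<noteq> ?b"
  then obtain \<phi> where \<phi>: "Vector_Spaces.linear s3 (*) \<phi>" "\<phi> (?a - ?b) \<noteq> 0"
    using separating_functional[OF vs(3), of "?a - ?b"] by auto
  interpret \<phi>: Vector_Spaces.linear s3 "(*)" \<phi> by (rule \<phi>(1))
  obtain p where p: "Vector_Spaces.linear s1 s1 p" "range p \<subseteq> V" "\<And>x. x \<in> V \<Longrightarrow> p x = x"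
    using subspace_projection[OF vs(1) VW(1)] by auto
  obtain q where q: "Vector_Spaces.linear s2 s2 q" "range q \<subseteq> W" "\<And>x. x \<in> W \<Longrightarrow> q x = x"
    using subspace_projection[OF vs(2) VW(2)] by auto
  define \<beta> where "\<beta> x y = \<phi> (f (p x) (q y))" for x y
  have \<beta>: "bilinear_on s1 s2 (*) UNIV UNIV \<beta>"
    unfolding bilinear_on_def \<beta>_def
  proof (intro conjI ballI)
    fix y
    have "linear_on s1 s3 V UNIV (\<lambda>x. f x (q y))" using f q(2) by (auto simp: bilinear_on_def)
    from linear_on_compose_linear[OF this \<phi>(1) p(1,2)]
    show "linear_on s1 (*) UNIV UNIV (\<lambda>x. \<phi> (f (p x) (q y)))" .
  next
    fix x
    have "linear_on s2 s3 W UNIV (f (p x))" using f p(2) by (auto simp: bilinear_on_def)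
    from linear_on_compose_linear[OF this \<phi>(1) q(1,2)]
    show "linear_on s2 (*) UNIV UNIV (\<lambda>y. \<phi> (f (p x) (q y)))" .
  qed
  have ev: "(\<Sum>(x, y)\<leftarrow>rs. tensor s1 s2 x y) \<beta> = \<phi> (\<Sum>(x, y)\<leftarrow>rs. f x y)"
    if "set rs \<subseteq> V \<times> W" for rs
    using that
    by (induction rs) (auto simp: tensor_def \<beta> \<beta>_def p(3) q(3) \<phi>.add \<phi>.zero)
  have "\<phi> ?a = \<phi> ?b"
    using ev[OF ps] ev[OF qs] eq by simp
  with \<phi>(2) show False by (simp add: \<phi>.diff)
qed

lemma tensor_lift_sum:
  assumes "vector_space s1" "vector_space s2" "vector_space s3"
    and "module.subspace s1 V" "module.subspace s2 W"
    and "bilinear_on s1 s2 s3 V W f"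
    and "set ps \<subseteq> V \<times> W"
  shows "tensor_lift s1 s2 V W f (\<Sum>(x, y)\<leftarrow>ps. tensor s1 s2 x y) = (\<Sum>(x, y)\<leftarrow>ps. f x y)"
proof -
  let ?P = "\<lambda>qs. set qs \<subseteq> V \<times> W \<and>
    (\<Sum>(x, y)\<leftarrow>ps. tensor s1 s2 x y) = (\<Sum>(x, y)\<leftarrow>qs. tensor s1 s2 x y)"
  have "?P (SOME qs. ?P qs)" by (rule someI[of ?P ps]) (use assms in auto)
  then show ?thesis
    unfolding tensor_lift_def Let_def
    by (intro bilinear_sum_eq[OF assms(1-6), symmetric] assms(7)) auto
qed

lemma linear_on_sum_list:
  assumes "vector_space s1" "vector_space s2" "module.subspace s1 V"
    and "linear_on s1 s2 V W g" "set xs \<subseteq> V"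
  shows "sum_list xs \<in> V \<and> g (sum_list xs) = (\<Sum>x\<leftarrow>xs. g x)"
proof -
  interpret V1: vector_space s1 by fact
  interpret V2: vector_space s2 by fact
  have 0: "0 \<in> V" using assms(3) by (rule V1.subspace_0)
  have "g (s1 0 0) = s2 0 (g 0)" using assms(4) 0 unfolding linear_on_def by blast
  then have "g 0 = 0" by simp
  with assms(5) 0 show ?thesis
    using assms(4) V1.subspace_add[OF assms(3)] by (induction xs) (auto simp: linear_on_def)
qed

theorem tensor_universal_property:
  assumes vs: "vector_space s1" "vector_space s2" "vector_space s3"
    and VW: "module.subspace s1 V" "module.subspace s2 W"
    and f: "bilinear_on s1 s2 s3 V W f"
  shows "linear_on tensor_scale s3 (tensor_space s1 s2 V W) UNIV (tensor_lift s1 s2 V W f)"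
    and "x \<in> V \<Longrightarrow> y \<in> W \<Longrightarrow> tensor_lift s1 s2 V W f (tensor s1 s2 x y) = f x y"
    and "linear_on tensor_scale s3 (tensor_space s1 s2 V W) UNIV g \<Longrightarrow>
         (\<And>x y. x \<in> V \<Longrightarrow> y \<in> W \<Longrightarrow> g (tensor s1 s2 x y) = f x y) \<Longrightarrow>
         t \<in> tensor_space s1 s2 V W \<Longrightarrow> g t = tensor_lift s1 s2 V W f t"
proof -
  interpret T: vector_space "tensor_scale :: 'a \<Rightarrow> ('a,'b,'c) tensor \<Rightarrow> _"
    by (rule vector_space_tensor_scale)
  interpret V1: vector_space s1 by fact
  interpret V3: vector_space s3 by fact
  note lift = tensor_lift_sum[OF vs VW f]
  note rep = tensor_space_sum_list[OF vs(1,2) VW(1)]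
  show "linear_on tensor_scale s3 (tensor_space s1 s2 V W) UNIV (tensor_lift s1 s2 V W f)"
    unfolding linear_on_def
  proof (intro conjI ballI allI)
    fix t u assume "t \<in> tensor_space s1 s2 V W" "u \<in> tensor_space s1 s2 V W"
    then obtain ps qs where "set ps \<subseteq> V \<times> W" "t = (\<Sum>(x, y)\<leftarrow>ps. tensor s1 s2 x y)"
      "set qs \<subseteq> V \<times> W" "u = (\<Sum>(x, y)\<leftarrow>qs. tensor s1 s2 x y)"
      using rep by meson
    then show "tensor_lift s1 s2 V W f (t + u) = tensor_lift s1 s2 V W f t + tensor_lift s1 s2 V W f u"
      using lift[of "ps @ qs"] lift[of ps] lift[of qs] by simp
  next
    fix c t assume "t \<in> tensor_space s1 s2 V W"
    then obtain ps where ps: "set ps \<subseteq> V \<times> W" "t = (\<Sum>(x, y)\<leftarrow>ps. tensor s1 s2 x y)"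
      using rep by meson
    let ?ps = "map (\<lambda>(x, y). (s1 c x, y)) ps"
    have set: "set ?ps \<subseteq> V \<times> W"
      using ps(1) V1.subspace_scale[OF VW(1)] by auto
    have "tensor_scale c (\<Sum>(x, y)\<leftarrow>ps. tensor s1 s2 x y) = (\<Sum>(x, y)\<leftarrow>?ps. tensor s1 s2 x y)"
      using ps(1) bilinear_on_scale_left[OF bilinear_on_tensor[OF vs(1,2)]]
      by (induction ps) (auto simp: T.scale_right_distrib)
    moreover have "s3 c (\<Sum>(x, y)\<leftarrow>ps. f x y) = (\<Sum>(x, y)\<leftarrow>?ps. f x y)"
      using ps(1) bilinear_on_scale_left[OF f]
      by (induction ps) (auto simp: V3.scale_right_distrib)
    ultimately show "tensor_lift s1 s2 V W f (tensor_scale c t) = s3 c (tensor_lift s1 s2 V W f t)"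
      using lift[OF set] lift[OF ps(1)] ps(2) by simp
  qed simp
  show "tensor_lift s1 s2 V W f (tensor s1 s2 x y) = f x y" if "x \<in> V" "y \<in> W"
    using lift[of "[(x, y)]"] that by simp
  show "g t = tensor_lift s1 s2 V W f t"
    if g: "linear_on tensor_scale s3 (tensor_space s1 s2 V W) UNIV g"
      and gf: "\<And>x y. x \<in> V \<Longrightarrow> y \<in> W \<Longrightarrow> g (tensor s1 s2 x y) = f x y"
      and t: "t \<in> tensor_space s1 s2 V W"
  proof -
    obtain ps where ps: "set ps \<subseteq> V \<times> W" "t = (\<Sum>(x, y)\<leftarrow>ps. tensor s1 s2 x y)"
      using rep[OF t] by (elim exE conjE) (rule that)
    have "set (map (\<lambda>(x, y). tensor s1 s2 x y) ps) \<subseteq> tensor_space s1 s2 V W"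
      using ps(1) by (auto simp: tensor_space_def intro!: T.span_base)
    from linear_on_sum_list[OF vector_space_tensor_scale vs(3) _ g this]
    have "g t = (\<Sum>u\<leftarrow>map (\<lambda>(x, y). tensor s1 s2 x y) ps. g u)"
      unfolding ps(2) by (simp add: tensor_space_def T.subspace_span)
    also have "\<dots> = (\<Sum>(x, y)\<leftarrow>ps. f x y)"
      using ps(1) gf by (induction ps) auto
    finally show ?thesis using lift[OF ps(1)] ps(2) by simp
  qed
qed

text \<open>
  \<open>f \<otimes> g\<close> on \<open>V \<otimes> W\<close>; \<open>s1, s2\<close> are the scalar multiplications of the domains and
  \<open>r1, r2\<close> those of the codomains.
\<close>

definition tensor_map ::
  "('k::field \<Rightarrow> 'a::ab_group_add \<Rightarrow> 'a) \<Rightarrow> ('k \<Rightarrow> 'b::ab_group_add \<Rightarrow> 'b) \<Rightarrow>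
   ('k \<Rightarrow> 'c::ab_group_add \<Rightarrow> 'c) \<Rightarrow> ('k \<Rightarrow> 'd::ab_group_add \<Rightarrow> 'd) \<Rightarrow>
   'a set \<Rightarrow> 'b set \<Rightarrow> ('a \<Rightarrow> 'c) \<Rightarrow> ('b \<Rightarrow> 'd) \<Rightarrow> ('k, 'a, 'b) tensor \<Rightarrow> ('k, 'c, 'd) tensor" where
  "tensor_map s1 s2 r1 r2 V W f g = tensor_lift s1 s2 V W (\<lambda>x y. tensor r1 r2 (f x) (g y))"

text \<open>The canonical isomorphism from \<open>(U \<otimes> V) \<otimes> W\<close> to \<open>U \<otimes> (V \<otimes> W)\<close>.\<close>

definition tensor_assoc ::
  "('k::field \<Rightarrow> 'a::ab_group_add \<Rightarrow> 'a) \<Rightarrow> ('k \<Rightarrow> 'b::ab_group_add \<Rightarrow> 'b) \<Rightarrow>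
   ('k \<Rightarrow> 'c::ab_group_add \<Rightarrow> 'c) \<Rightarrow> 'a set \<Rightarrow> 'b set \<Rightarrow> 'c set \<Rightarrow>
   ('k, ('k, 'a, 'b) tensor, 'c) tensor \<Rightarrow> ('k, 'a, ('k, 'b, 'c) tensor) tensor" where
  "tensor_assoc s1 s2 s3 U V W =
     tensor_lift tensor_scale s3 (tensor_space s1 s2 U V) W
       (\<lambda>t z. tensor_lift s1 s2 U V (\<lambda>x y. tensor s1 tensor_scale x (tensor s2 s3 y z)) t)"

text \<open>
  The product \<open>(x \<otimes> y)(x' \<otimes> y') = xx' \<otimes> yy'\<close> on \<open>V \<otimes> W\<close> induced by products
  \<open>m1\<close> on \<open>V\<close> and \<open>m2\<close> on \<open>W\<close>.
\<close>

definition tensor_mult ::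
  "('k::field \<Rightarrow> 'a::ab_group_add \<Rightarrow> 'a) \<Rightarrow> ('k \<Rightarrow> 'b::ab_group_add \<Rightarrow> 'b) \<Rightarrow>
   'a set \<Rightarrow> 'b set \<Rightarrow> ('a \<Rightarrow> 'a \<Rightarrow> 'a) \<Rightarrow> ('b \<Rightarrow> 'b \<Rightarrow> 'b) \<Rightarrow>
   ('k, 'a, 'b) tensor \<Rightarrow> ('k, 'a, 'b) tensor \<Rightarrow> ('k, 'a, 'b) tensor" where
  "tensor_mult s1 s2 V W m1 m2 t u =
     tensor_lift s1 s2 V W (\<lambda>x y.
       tensor_lift s1 s2 V W (\<lambda>x' y'. tensor s1 s2 (m1 x x') (m2 y y')) u) t"


section \<open>Coalgebras, comodules and Rota-Baxter operators\<close>

locale coalgebra = vector_space s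
  for s :: "'k::field \<Rightarrow> 'c::ab_group_add \<Rightarrow> 'c" +
  fixes C :: "'c set"
    and \<Delta> :: "'c \<Rightarrow> ('k, 'c, 'c) tensor"
    and \<epsilon> :: "'c \<Rightarrow> 'k"
  assumes subspace_carrier: "module.subspace s C"
    and comult_linear: "linear_on s tensor_scale C (tensor_space s s C C) \<Delta>"
    and counit_linear: "linear_on s (*) C UNIV \<epsilon>"
    and coassoc: "c \<in> C \<Longrightarrow>
      tensor_assoc s s s C C C (tensor_map s s tensor_scale s C C \<Delta> id (\<Delta> c)) =
      tensor_map s s s tensor_scale C C id \<Delta> (\<Delta> c)"
    and counit_left: "c \<in> C \<Longrightarrow> tensor_lift s s C C (\<lambda>x y. s (\<epsilon> x) y) (\<Delta> c) = c"
    and counit_right: "c \<in> C \<Longrightarrow> tensor_lift s s C C (\<lambda>x y. s (\<epsilon> y) x) (\<Delta> c) = c"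

locale left_comodule = coalgebra s C \<Delta> \<epsilon> + M: vector_space sm
  for s :: "'k::field \<Rightarrow> 'c::ab_group_add \<Rightarrow> 'c" and C \<Delta> \<epsilon>
    and sm :: "'k \<Rightarrow> 'm::ab_group_add \<Rightarrow> 'm" +
  fixes M :: "'m set"
    and \<rho> :: "'m \<Rightarrow> ('k, 'c, 'm) tensor"
  assumes subspace_comodule: "module.subspace sm M"
    and coaction_linear: "linear_on sm tensor_scale M (tensor_space s sm C M) \<rho>"
    and coaction_coassoc: "m \<in> M \<Longrightarrow>
      tensor_assoc s s sm C C M (tensor_map s sm tensor_scale sm C M \<Delta> id (\<rho> m)) =
      tensor_map s sm s tensor_scale C M id \<rho> (\<rho> m)"
    and coaction_counit: "m \<in> M \<Longrightarrow> tensor_lift s sm C M (\<lambda>x y. sm (\<epsilon> x) y) (\<rho> m) = m"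

locale rota_baxter_paired_comodule = left_comodule s C \<Delta> \<epsilon> sm M \<rho>
  for s :: "'k::field \<Rightarrow> 'c::ab_group_add \<Rightarrow> 'c" and C \<Delta> \<epsilon>
    and sm :: "'k \<Rightarrow> 'm::ab_group_add \<Rightarrow> 'm" and M \<rho> +
  fixes P :: "'c \<Rightarrow> 'c" and T :: "'m \<Rightarrow> 'm" and wt :: 'k
  assumes coalgebra_op_linear: "linear_on s s C C P"
    and comodule_op_linear: "linear_on sm sm M M T"
    and paired_identity: "m \<in> M \<Longrightarrow>
      tensor_map s sm s sm C M P T (\<rho> m) =
      tensor_map s sm s sm C M P id (\<rho> (T m)) +
      tensor_map s sm s sm C M id T (\<rho> (T m)) +
      tensor_scale wt (\<rho> (T m))"

locale rota_baxter_coalgebra = coalgebra s C \<Delta> \<epsilon>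
  for s :: "'k::field \<Rightarrow> 'c::ab_group_add \<Rightarrow> 'c" and C \<Delta> \<epsilon> +
  fixes P :: "'c \<Rightarrow> 'c" and wt :: 'k
  assumes op_linear: "linear_on s s C C P"
    and rota_baxter_identity: "c \<in> C \<Longrightarrow>
      tensor_map s s s s C C P P (\<Delta> c) =
      tensor_map s s s s C C P id (\<Delta> (P c)) +
      tensor_map s s s s C C id P (\<Delta> (P c)) +
      tensor_scale wt (\<Delta> (P c))"


section \<open>Weak bialgebras and weak Hopf algebras\<close>

text \<open>
  The unital ring structure of \<open>H\<close> comes from the sort; \<open>ring_1\<close> would exclude the zero algebra.
\<close>

locale weak_bialgebra = coalgebra s "UNIV :: 'h set" \<Delta> \<epsilon>
  for s :: "'k::field \<Rightarrow> 'h::{ring, monoid_mult} \<Rightarrow> 'h" and \<Delta> \<epsilon> +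
  assumes scale_mult_left: "s c (x * y) = s c x * y"
    and scale_mult_right: "s c (x * y) = x * s c y"
    and comult_mult: "\<Delta> (x * y) = tensor_mult s s UNIV UNIV (*) (*) (\<Delta> x) (\<Delta> y)"
    and counit_mult1: "\<epsilon> (x * y * z) =
      tensor_lift s s UNIV UNIV (\<lambda>y1 y2. \<epsilon> (x * y1) * \<epsilon> (y2 * z)) (\<Delta> y)"
    and counit_mult2: "\<epsilon> (x * y * z) =
      tensor_lift s s UNIV UNIV (\<lambda>y1 y2. \<epsilon> (x * y2) * \<epsilon> (y1 * z)) (\<Delta> y)"
      \<comment> \<open>The next two identities live in \<open>H \<otimes> (H \<otimes> H)\<close>.\<close>
    and comult_one1:
      "tensor_assoc s s s UNIV UNIV UNIV (tensor_map s s tensor_scale s UNIV UNIV \<Delta> id (\<Delta> 1)) =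
       tensor_mult s tensor_scale UNIV (tensor_space s s UNIV UNIV)
         (*) (tensor_mult s s UNIV UNIV (*) (*))
         (tensor_assoc s s s UNIV UNIV UNIV (tensor tensor_scale s (\<Delta> 1) 1))
         (tensor s tensor_scale 1 (\<Delta> 1))"
    and comult_one2:
      "tensor_assoc s s s UNIV UNIV UNIV (tensor_map s s tensor_scale s UNIV UNIV \<Delta> id (\<Delta> 1)) =
       tensor_mult s tensor_scale UNIV (tensor_space s s UNIV UNIV)
         (*) (tensor_mult s s UNIV UNIV (*) (*))
         (tensor s tensor_scale 1 (\<Delta> 1))
         (tensor_assoc s s s UNIV UNIV UNIV (tensor tensor_scale s (\<Delta> 1) 1))"

definition sqcap_L :: "('k::field \<Rightarrow> 'h::{ring, monoid_mult} \<Rightarrow> 'h) \<Rightarrow>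
    ('h \<Rightarrow> ('k, 'h, 'h) tensor) \<Rightarrow> ('h \<Rightarrow> 'k) \<Rightarrow> 'h \<Rightarrow> 'h" where
  "sqcap_L s \<Delta> \<epsilon> h = tensor_lift s s UNIV UNIV (\<lambda>x y. s (\<epsilon> (x * h)) y) (\<Delta> 1)"

definition sqcap_R :: "('k::field \<Rightarrow> 'h::{ring, monoid_mult} \<Rightarrow> 'h) \<Rightarrow>
    ('h \<Rightarrow> ('k, 'h, 'h) tensor) \<Rightarrow> ('h \<Rightarrow> 'k) \<Rightarrow> 'h \<Rightarrow> 'h" where
  "sqcap_R s \<Delta> \<epsilon> h = tensor_lift s s UNIV UNIV (\<lambda>x y. s (\<epsilon> (h * y)) x) (\<Delta> 1)"

locale weak_hopf_algebra = weak_bialgebra s \<Delta> \<epsilon>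
  for s :: "'k::field \<Rightarrow> 'h::{ring, monoid_mult} \<Rightarrow> 'h" and \<Delta> \<epsilon> +
  fixes S :: "'h \<Rightarrow> 'h"
  assumes antipode_linear: "Vector_Spaces.linear s s S"
    and antipode_left: "tensor_lift s s UNIV UNIV (\<lambda>h1 h2. h1 * S h2) (\<Delta> h) = sqcap_L s \<Delta> \<epsilon> h"
    and antipode_right: "tensor_lift s s UNIV UNIV (\<lambda>h1 h2. S h1 * h2) (\<Delta> h) = sqcap_R s \<Delta> \<epsilon> h"
    and antipode_triple:
      "tensor_lift tensor_scale s (tensor_space s s UNIV UNIV) UNIV
         (\<lambda>t h3. tensor_lift s s UNIV UNIV (\<lambda>h1 h2. S h1 * h2) t * S h3)
         (tensor_map s s tensor_scale s UNIV UNIV \<Delta> id (\<Delta> h)) = S h"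

definition base_L :: "('k::field \<Rightarrow> 'h::{ring, monoid_mult} \<Rightarrow> 'h) \<Rightarrow>
    ('h \<Rightarrow> ('k, 'h, 'h) tensor) \<Rightarrow> ('h \<Rightarrow> 'k) \<Rightarrow> 'h set" where
  "base_L s \<Delta> \<epsilon> = range (sqcap_L s \<Delta> \<epsilon>)"

definition base_R :: "('k::field \<Rightarrow> 'h::{ring, monoid_mult} \<Rightarrow> 'h) \<Rightarrow>
    ('h \<Rightarrow> ('k, 'h, 'h) tensor) \<Rightarrow> ('h \<Rightarrow> 'k) \<Rightarrow> 'h set" where
  "base_R s \<Delta> \<epsilon> = range (sqcap_R s \<Delta> \<epsilon>)"

definition base_LR :: "('k::field \<Rightarrow> 'h::{ring, monoid_mult} \<Rightarrow> 'h) \<Rightarrow>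
    ('h \<Rightarrow> ('k, 'h, 'h) tensor) \<Rightarrow> ('h \<Rightarrow> 'k) \<Rightarrow> 'h set" where
  "base_LR s \<Delta> \<epsilon> = module.span s {x * y | x y. x \<in> base_L s \<Delta> \<epsilon> \<and> y \<in> base_R s \<Delta> \<epsilon>}"

end

theory Submission
  imports Defs
begin

text \<open>
  For \<open>x \<in> H\<^sup>L\<close> and \<open>y \<in> H\<^sup>R\<close> one has \<open>\<Delta>(xy) = x1\<^sub>1 \<otimes> 1\<^sub>2y\<close>, and \<open>\<sqinter>\<^sup>L\<close> is left \<open>H\<^sup>L\<close>-linear.
  Put \<open>t = \<sqinter>\<^sup>L(y)\<close>, so that \<open>\<sqinter>\<^sup>L(xy) = xt \<in> H\<^sup>L\<close>. As \<open>1\<^sub>1 \<otimes> \<sqinter>\<^sup>L(1\<^sub>2) = \<Delta>(1)\<close>, the last two terms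
  of the Rota-Baxter identity cancel, and the identity reduces to
  \<open>x\<sqinter>\<^sup>L(1\<^sub>1) \<otimes> 1\<^sub>2t = xt\<sqinter>\<^sup>L(1\<^sub>1) \<otimes> 1\<^sub>2\<close>: the element \<open>\<sqinter>\<^sup>L(1\<^sub>1) \<otimes> 1\<^sub>2\<close> is a separability
  idempotent of \<open>H\<^sup>L\<close>. The latter amounts to right \<open>H\<^sup>L\<close>-linearity of \<open>h \<mapsto> \<epsilon>(h1\<^sub>1)1\<^sub>2\<close>.
  Bilinear maps evaluated on \<open>\<Delta>(h)\<close> play the role of Sweedler notation.
\<close>

section \<open>Maps induced on tensor products\<close>

text \<open>The choice made inside \<open>tensor_lift\<close>, named because it does not depend on
  \<open>f\<close>: for fixed carriers and \<open>t\<close>, every lift is a sum over one and the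
  same list. Additivity in \<open>f\<close> and the exchange of two lifts then become facts about
  list sums, valid for arbitrary functions.\<close>

definition tensor_rep :: "('k::field \<Rightarrow> 'a::ab_group_add \<Rightarrow> 'a) \<Rightarrow> ('k \<Rightarrow> 'b::ab_group_add \<Rightarrow> 'b) \<Rightarrow>
    'a set \<Rightarrow> 'b set \<Rightarrow> ('k, 'a, 'b) tensor \<Rightarrow> ('a \<times> 'b) list" where
  "tensor_rep s1 s2 V W t =
     (SOME ps. set ps \<subseteq> V \<times> W \<and> t = (\<Sum>(x, y)\<leftarrow>ps. tensor s1 s2 x y))"

lemma tensor_lift_rep:
  "tensor_lift s1 s2 V W f t = (\<Sum>p\<leftarrow>tensor_rep s1 s2 V W t. f (fst p) (snd p))"
  by (simp add: tensor_lift_def tensor_rep_def case_prod_unfold)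

lemma tensor_linear:
  "tensor s1 s2 (x + x') y = tensor s1 s2 x y + tensor s1 s2 x' y"
  "tensor s1 s2 x (y + y') = tensor s1 s2 x y + tensor s1 s2 x y'"
  "tensor s1 s2 (s1 c x) y = tensor_scale c (tensor s1 s2 x y)"
  "tensor s1 s2 x (s2 c y) = tensor_scale c (tensor s1 s2 x y)"
  by (auto simp: bilinear_on_def linear_on_def tensor_def tensor_scale_def fun_eq_iff)

lemma tensor_rep:
  assumes "vector_space s1" "vector_space s2" "module.subspace s1 V" "t \<in> tensor_space s1 s2 V W"
  shows "set (tensor_rep s1 s2 V W t) \<subseteq> V \<times> W"
    and "(\<Sum>(x, y)\<leftarrow>tensor_rep s1 s2 V W t. tensor s1 s2 x y) = t"
  using someI_ex[OF tensor_space_sum_list[OF assms]] unfolding tensor_rep_def by auto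

lemma tensor_lift_tensor:
  assumes "vector_space s1" "vector_space s2" "module.subspace s1 V" "t \<in> tensor_space s1 s2 V W"
  shows "tensor_lift s1 s2 V W (tensor s1 s2) t = t"
  using tensor_rep[OF assms] by (simp add: tensor_lift_rep case_prod_unfold)

lemma tensor_lift_cong:
  assumes "vector_space s1" "vector_space s2" "module.subspace s1 V" "t \<in> tensor_space s1 s2 V W"
    and "\<And>x y. x \<in> V \<Longrightarrow> y \<in> W \<Longrightarrow> f x y = g x y"
  shows "tensor_lift s1 s2 V W f t = tensor_lift s1 s2 V W g t"
  unfolding tensor_lift_rep using tensor_rep(1)[OF assms(1-4)] assms(5)
  by (intro arg_cong[where f = sum_list] map_cong) auto

lemma module_tensor_scale: "module tensor_scale"
  by (simp add: module_iff_vector_space vector_space_tensor_scale)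

lemma tensor_space_mono:
  "V \<subseteq> V' \<Longrightarrow> W \<subseteq> W' \<Longrightarrow> tensor_space s1 s2 V W \<subseteq> tensor_space s1 s2 V' W'"
  unfolding tensor_space_def
  by (rule module.span_mono[OF module_tensor_scale]) auto

lemma subspace_tensor_space: "module.subspace tensor_scale (tensor_space s1 s2 V W)"
  unfolding tensor_space_def
  by (rule module.subspace_span[OF module_tensor_scale])

lemma tensor_in_tensor_space: "x \<in> V \<Longrightarrow> y \<in> W \<Longrightarrow> tensor s1 s2 x y \<in> tensor_space s1 s2 V W"
  unfolding tensor_space_def
  by (rule module.span_base[OF module_tensor_scale]) auto

text \<open>An expression of \<open>t\<close> chosen over the smaller carriers is also one over the
  larger, and a bilinear map gives the same sum on any two expressions. The lemma is needed because
  the choice in \<open>tensor_lift\<close> depends on the carriers even when the tensor is the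
  same.\<close>

lemma tensor_lift_restrict:
  assumes "vector_space s1" "vector_space s2" "vector_space s3"
    and "module.subspace s1 V" "module.subspace s1 V'" "module.subspace s2 W'"
    and "bilinear_on s1 s2 s3 V' W' f"
    and "V \<subseteq> V'" "W \<subseteq> W'" "t \<in> tensor_space s1 s2 V W"
  shows "tensor_lift s1 s2 V W f t = tensor_lift s1 s2 V' W' f t"
proof -
  note rep = tensor_rep[OF assms(1,2,4,10)]
  have "set (tensor_rep s1 s2 V W t) \<subseteq> V' \<times> W'" using rep(1) assms(8,9) by auto
  from tensor_lift_sum[OF assms(1,2,3,5,6,7) this] show ?thesis
    unfolding rep(2) by (simp add: tensor_lift_rep case_prod_unfold)
qed

lemma linear_on_tensor_lift:
  assumes "vector_space s1" "vector_space s2" "module.subspace s1 V" "t \<in> tensor_space s1 s2 V W"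
    and "module.subspace sa A" "vector_space sa" "vector_space sb"
    and "linear_on sa sb A B g"
    and "\<And>x y. x \<in> V \<Longrightarrow> y \<in> W \<Longrightarrow> f x y \<in> A"
  shows tensor_lift_in: "tensor_lift s1 s2 V W f t \<in> A"
    and tensor_lift_apply: "g (tensor_lift s1 s2 V W f t) = tensor_lift s1 s2 V W (\<lambda>x y. g (f x y)) t"
proof -
  have "set (map (\<lambda>p. f (fst p) (snd p)) (tensor_rep s1 s2 V W t)) \<subseteq> A"
    using tensor_rep(1)[OF assms(1-4)] assms(9) by auto
  from linear_on_sum_list[OF assms(6,7,5,8) this]
  show "tensor_lift s1 s2 V W f t \<in> A"
    "g (tensor_lift s1 s2 V W f t) = tensor_lift s1 s2 V W (\<lambda>x y. g (f x y)) t"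
    unfolding tensor_lift_rep by (auto simp: comp_def)
qed

lemma tensor_lift_add:
  "tensor_lift s1 s2 V W (\<lambda>x y. f x y + g x y) t = tensor_lift s1 s2 V W f t + tensor_lift s1 s2 V W g t"
  unfolding tensor_lift_rep by (rule sum_list_addf)

lemma sum_list_swap:
  fixes h :: "'a \<Rightarrow> 'b \<Rightarrow> 'c::comm_monoid_add"
  shows "(\<Sum>p\<leftarrow>ps. \<Sum>q\<leftarrow>qs. h p q) = (\<Sum>q\<leftarrow>qs. \<Sum>p\<leftarrow>ps. h p q)"
  by (induction ps) (simp_all add: sum_list_addf)

lemma tensor_lift_swap:
  "tensor_lift s1 s2 V W (\<lambda>x y. tensor_lift s3 s4 V' W' (f x y) u) t =
   tensor_lift s3 s4 V' W' (\<lambda>x' y'. tensor_lift s1 s2 V W (\<lambda>x y. f x y x' y') t) u"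
  unfolding tensor_lift_rep by (rule sum_list_swap)

text \<open>A finite sum of linear maps is linear. This complements the universal property, which
  gives linearity in the tensor rather than in a parameter.\<close>

lemma linear_on_tensor_lift_param:
  assumes "vector_space s1" "vector_space s2" "module.subspace s1 V" "t \<in> tensor_space s1 s2 V W"
    and "vector_space sb"
    and "\<And>x y. x \<in> V \<Longrightarrow> y \<in> W \<Longrightarrow> linear_on sa sb A UNIV (\<lambda>a. f a x y)"
  shows "linear_on sa sb A UNIV (\<lambda>a. tensor_lift s1 s2 V W (f a) t)"
proof -
  interpret sb: vector_space sb by fact
  have "linear_on sa sb A UNIV (\<lambda>a. \<Sum>p\<leftarrow>ps. f a (fst p) (snd p))" if "set ps \<subseteq> V \<times> W" for ps
    using that
  proof (induction ps)
    case (Cons p ps)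
    then have "linear_on sa sb A UNIV (\<lambda>a. \<Sum>p\<leftarrow>ps. f a (fst p) (snd p))"
      "linear_on sa sb A UNIV (\<lambda>a. f a (fst p) (snd p))" using assms(6) by auto
    then show ?case by (auto simp: linear_on_def algebra_simps sb.scale_right_distrib)
  qed (auto simp: linear_on_def)
  with tensor_rep(1)[OF assms(1-4)] show ?thesis by (simp add: tensor_lift_rep)
qed

lemma bilinear_on_compose:
  assumes "bilinear_on r1 r2 s3 V' W' f" "linear_on s1 r1 V V' p" "linear_on s2 r2 W W' q"
  shows "bilinear_on s1 s2 s3 V W (\<lambda>x y. f (p x) (q y))"
  using assms unfolding bilinear_on_def linear_on_def image_subset_iff by (simp del: Set.ball_simps)

lemma tensor_map_restrict:
  assumes "vector_space s1" "vector_space s2" "vector_space r1" "vector_space r2"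
    and "module.subspace s1 V" "module.subspace s1 V'" "module.subspace s2 W'"
    and "linear_on s1 r1 V' UNIV f" "linear_on s2 r2 W' UNIV g"
    and "V \<subseteq> V'" "W \<subseteq> W'" "t \<in> tensor_space s1 s2 V W"
  shows "tensor_map s1 s2 r1 r2 V W f g t = tensor_map s1 s2 r1 r2 V' W' f g t"
  unfolding tensor_map_def
  by (rule tensor_lift_restrict[OF assms(1,2) vector_space_tensor_scale assms(5-7) _ assms(10-12)]
      bilinear_on_compose[OF bilinear_on_tensor[OF assms(3,4)] assms(8,9)])+

text \<open>Linearity in \<open>t\<close> is the universal property, linearity in \<open>z\<close>
  that of a sum of linear maps. It makes the outer lift in \<open>tensor_assoc\<close> independent
  of the chosen expression.\<close>

lemma bilinear_on_tensor_assoc: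
  assumes "vector_space s1" "vector_space s2" "vector_space s3"
    and "module.subspace s1 U" "module.subspace s2 V"
  shows "bilinear_on tensor_scale s3 tensor_scale (tensor_space s1 s2 U V) W
     (\<lambda>t z. tensor_lift s1 s2 U V (\<lambda>x y. tensor s1 tensor_scale x (tensor s2 s3 y z)) t)"
proof -
  note T = vector_space_tensor_scale
  have b: "bilinear_on s1 s2 tensor_scale U V (\<lambda>x y. tensor s1 tensor_scale x (tensor s2 s3 y z))" for z
    by (auto simp: bilinear_on_def linear_on_def tensor_linear)
  show ?thesis
    unfolding bilinear_on_def
  proof (intro conjI ballI)
    fix z assume "z \<in> W"
    show "linear_on tensor_scale tensor_scale (tensor_space s1 s2 U V) UNIV
       (\<lambda>t. tensor_lift s1 s2 U V (\<lambda>x y. tensor s1 tensor_scale x (tensor s2 s3 y z)) t)"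
      by (rule tensor_universal_property(1)[OF assms(1,2) T assms(4,5) b])
  next
    fix t assume "t \<in> tensor_space s1 s2 U V"
    then show "linear_on s3 tensor_scale W UNIV
       (\<lambda>z. tensor_lift s1 s2 U V (\<lambda>x y. tensor s1 tensor_scale x (tensor s2 s3 y z)) t)"
      by (rule linear_on_tensor_lift_param[OF assms(1,2,4) _ T])
         (auto simp: linear_on_def tensor_linear)
  qed
qed

lemma tensor_assoc_restrict:
  assumes vs: "vector_space s1" "vector_space s2" "vector_space s3"
    and U: "module.subspace s1 U" "module.subspace s1 U'" "U \<subseteq> U'"
    and V: "module.subspace s2 V'" "V \<subseteq> V'"
    and W: "module.subspace s3 W'" "W \<subseteq> W'"
    and t: "t \<in> tensor_space tensor_scale s3 (tensor_space s1 s2 U V) W"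
  shows "tensor_assoc s1 s2 s3 U V W t = tensor_assoc s1 s2 s3 U' V' W' t"
proof -
  note T = vector_space_tensor_scale
  have b: "bilinear_on s1 s2 tensor_scale U' V' (\<lambda>x y. tensor s1 tensor_scale x (tensor s2 s3 y z))" for z
    by (auto simp: bilinear_on_def linear_on_def tensor_linear)
  \<comment> \<open>The nested lifts are enlarged in turn: the inner one first, at each tensor of
    the smaller space, then the outer one.\<close>
  have "tensor_assoc s1 s2 s3 U V W t =
     tensor_lift tensor_scale s3 (tensor_space s1 s2 U V) W
       (\<lambda>t z. tensor_lift s1 s2 U' V' (\<lambda>x y. tensor s1 tensor_scale x (tensor s2 s3 y z)) t) t"
    unfolding tensor_assoc_def
    by (rule tensor_lift_cong[OF T vs(3) subspace_tensor_space t]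
        tensor_lift_restrict[OF vs(1,2) T U(1,2) V(1) b U(3) V(2)] | assumption)+
  also have "\<dots> = tensor_assoc s1 s2 s3 U' V' W' t"
    unfolding tensor_assoc_def
    by (rule tensor_lift_restrict[OF T vs(3) T subspace_tensor_space subspace_tensor_space W(1)
          bilinear_on_tensor_assoc[OF vs U(2) V(1)] tensor_space_mono[OF U(3) V(2)] W(2) t])
  finally show ?thesis .
qed


section \<open>The factorwise product on a tensor product\<close>

context
  fixes s1 :: "'k::field \<Rightarrow> 'a::ab_group_add \<Rightarrow> 'a" and s2 :: "'k \<Rightarrow> 'b::ab_group_add \<Rightarrow> 'b"
    and V W m1 m2
  assumes vs: "vector_space s1" "vector_space s2"
    and VW: "module.subspace s1 V" "module.subspace s2 W"
    and m1: "bilinear_on s1 s1 s1 V V m1" and m2: "bilinear_on s2 s2 s2 W W m2"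
begin

lemma bilinear_on_tensor_mult_factor:
  assumes "x \<in> V" "y \<in> W"
  shows "bilinear_on s1 s2 tensor_scale V W (\<lambda>x' y'. tensor s1 s2 (m1 x x') (m2 y y'))"
    and "bilinear_on s1 s2 tensor_scale V W (\<lambda>x' y'. tensor s1 s2 (m1 x' x) (m2 y' y))"
  using assms m1 m2 by (auto simp: bilinear_on_def linear_on_def tensor_linear)

lemma bilinear_on_tensor_mult_lift:
  assumes "u \<in> tensor_space s1 s2 V W"
  shows "bilinear_on s1 s2 tensor_scale V W
    (\<lambda>x y. tensor_lift s1 s2 V W (\<lambda>x' y'. tensor s1 s2 (m1 x x') (m2 y y')) u)"
  unfolding bilinear_on_def
  by (intro ballI conjI; rule linear_on_tensor_lift_param[OF vs VW(1) assms vector_space_tensor_scale])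
     (use m1 m2 in \<open>auto simp: bilinear_on_def linear_on_def tensor_linear\<close>)

text \<open>The conclusion has the form required of \<open>m2\<close>, so the construction iterates:
  with \<open>H \<otimes> H\<close> as second carrier it yields the product on
  \<open>H \<otimes> (H \<otimes> H)\<close>. For this reason the factors are taken bilinear on
  carriers, not on whole types.\<close>

lemma bilinear_on_tensor_mult:
  "bilinear_on tensor_scale tensor_scale tensor_scale (tensor_space s1 s2 V W) (tensor_space s1 s2 V W)
    (tensor_mult s1 s2 V W m1 m2)"
  unfolding bilinear_on_def
proof (intro ballI conjI)
  fix u assume u: "u \<in> tensor_space s1 s2 V W"
  show "linear_on tensor_scale tensor_scale (tensor_space s1 s2 V W) UNIV
      (\<lambda>t. tensor_mult s1 s2 V W m1 m2 t u)"
    unfolding tensor_mult_def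
    by (rule tensor_universal_property(1)[OF vs vector_space_tensor_scale VW
          bilinear_on_tensor_mult_lift[OF u]])
next
  fix t assume t: "t \<in> tensor_space s1 s2 V W"
  show "linear_on tensor_scale tensor_scale (tensor_space s1 s2 V W) UNIV (tensor_mult s1 s2 V W m1 m2 t)"
    unfolding tensor_mult_def
    by (rule linear_on_tensor_lift_param[OF vs VW(1) t vector_space_tensor_scale])
       (rule tensor_universal_property(1)[OF vs vector_space_tensor_scale VW
          bilinear_on_tensor_mult_factor(1)])
qed

lemma tensor_mult_tensor_left:
  assumes "x \<in> V" "y \<in> W" "u \<in> tensor_space s1 s2 V W"
  shows "tensor_mult s1 s2 V W m1 m2 (tensor s1 s2 x y) u =
    tensor_lift s1 s2 V W (\<lambda>x' y'. tensor s1 s2 (m1 x x') (m2 y y')) u"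
  unfolding tensor_mult_def
  by (rule tensor_universal_property(2)[OF vs vector_space_tensor_scale VW
        bilinear_on_tensor_mult_lift[OF assms(3)] assms(1,2)])

lemma tensor_mult_tensor_right:
  assumes "x \<in> V" "y \<in> W" "t \<in> tensor_space s1 s2 V W"
  shows "tensor_mult s1 s2 V W m1 m2 t (tensor s1 s2 x y) =
    tensor_lift s1 s2 V W (\<lambda>x' y'. tensor s1 s2 (m1 x' x) (m2 y' y)) t"
  unfolding tensor_mult_def
  by (rule tensor_lift_cong[OF vs VW(1) assms(3)])
     (rule tensor_universal_property(2)[OF vs vector_space_tensor_scale VW
        bilinear_on_tensor_mult_factor(1) assms(1,2)])

lemma tensor_mult_tensor:
  assumes "x \<in> V" "y \<in> W" "x' \<in> V" "y' \<in> W"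
  shows "tensor_mult s1 s2 V W m1 m2 (tensor s1 s2 x y) (tensor s1 s2 x' y') =
    tensor s1 s2 (m1 x x') (m2 y y')"
  unfolding tensor_mult_tensor_left[OF assms(1,2) tensor_in_tensor_space[OF assms(3,4)]]
  by (rule tensor_universal_property(2)[OF vs vector_space_tensor_scale VW
        bilinear_on_tensor_mult_factor(1)[OF assms(1,2)] assms(3,4)])

end

section \<open>Sweedler calculus\<close>

lemma bilinear_on_UNIV_iff:
  "bilinear_on s1 s2 s3 UNIV UNIV f \<longleftrightarrow>
     (\<forall>x x' y. f (x + x') y = f x y + f x' y) \<and> (\<forall>x y y'. f x (y + y') = f x y + f x y') \<and>
     (\<forall>c x y. f (s1 c x) y = s3 c (f x y)) \<and> (\<forall>c x y. f x (s2 c y) = s3 c (f x y))"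
  by (auto simp: bilinear_on_def linear_on_def)

definition trilinear :: "('k::field \<Rightarrow> 'a::ab_group_add \<Rightarrow> 'a) \<Rightarrow> ('k \<Rightarrow> 'b::ab_group_add \<Rightarrow> 'b) \<Rightarrow>
    ('a \<Rightarrow> 'a \<Rightarrow> 'a \<Rightarrow> 'b) \<Rightarrow> bool" where
  "trilinear s s3 f \<longleftrightarrow> (\<forall>z. bilinear_on s s s3 UNIV UNIV (\<lambda>x y. f x y z)) \<and>
     (\<forall>x. bilinear_on s s s3 UNIV UNIV (f x))"

lemma vector_space_field: "vector_space ((*) :: 'k::field \<Rightarrow> 'k \<Rightarrow> 'k)"
  by unfold_locales (auto simp: algebra_simps)

context weak_bialgebra
begin

abbreviation HH :: "('k, 'h, 'h) tensor set" where
  "HH \<equiv> tensor_space s s UNIV UNIV"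

abbreviation sweedler :: "'h \<Rightarrow> ('h \<Rightarrow> 'h \<Rightarrow> 'c::ab_group_add) \<Rightarrow> 'c" where
  "sweedler h f \<equiv> tensor_lift s s UNIV UNIV f (\<Delta> h)"

abbreviation bilinear :: "('k \<Rightarrow> 'c::ab_group_add \<Rightarrow> 'c) \<Rightarrow> ('h \<Rightarrow> 'h \<Rightarrow> 'c) \<Rightarrow> bool" where
  "bilinear s3 f \<equiv> bilinear_on s s s3 UNIV UNIV f"

lemmas vs = vector_space_axioms
lemmas vsT = vector_space_tensor_scale

lemma comult_in: "\<Delta> h \<in> HH"
  using comult_linear by (auto simp: linear_on_def)

lemma comult_add: "\<Delta> (x + y) = \<Delta> x + \<Delta> y"
  and comult_scale: "\<Delta> (s c x) = tensor_scale c (\<Delta> x)"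
  using comult_linear by (auto simp: linear_on_def)

lemma counit_add: "\<epsilon> (x + y) = \<epsilon> x + \<epsilon> y"
  and counit_scale: "\<epsilon> (s c x) = c * \<epsilon> x"
  using counit_linear by (auto simp: linear_on_def)

lemma mult_scale: "s c x * y = s c (x * y)" "x * s c y = s c (x * y)"
  using scale_mult_left scale_mult_right by simp_all

lemmas linear_simps = counit_add counit_scale mult_scale distrib_left distrib_right
  scale_right_distrib scale_left_distrib

lemma sweedler_tensor: "sweedler h (tensor s s) = \<Delta> h"
  by (rule tensor_lift_tensor[OF vs vs subspace_UNIV comult_in])

lemma sweedler_apply_on:
  assumes "vector_space sa" "vector_space sb" "module.subspace sa A"
    and "linear_on sa sb A B g" "\<And>x y. f x y \<in> A"
  shows "g (sweedler h f) = sweedler h (\<lambda>x y. g (f x y))"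
  by (rule tensor_lift_apply[OF vs vs subspace_UNIV comult_in assms(3,1,2,4,5)])

lemma sweedler_apply:
  assumes "vector_space sa" "vector_space sb"
    and "\<And>x y. g (x + y) = g x + g y" "\<And>c x. g (sa c x) = sb c (g x)"
  shows "g (sweedler h f) = sweedler h (\<lambda>x y. g (f x y))"
proof -
  interpret sa: vector_space sa by fact
  show ?thesis
    by (rule sweedler_apply_on[OF assms(1,2) sa.subspace_UNIV, where B = UNIV])
       (auto simp: linear_on_def assms)
qed

lemma sweedler_counit: "\<epsilon> (sweedler h f) = sweedler h (\<lambda>x y. \<epsilon> (f x y))"
  by (rule sweedler_apply[OF vs vector_space_field]) (simp_all add: linear_simps)

lemma sweedler_mult_right: "sweedler h f * (z :: 'h) = sweedler h (\<lambda>x y. f x y * z)"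
  by (rule sweedler_apply[OF vs vs, where g = "\<lambda>u. u * z"]) (simp_all add: linear_simps)

lemma sweedler_mult_left: "(z :: 'h) * sweedler h f = sweedler h (\<lambda>x y. z * f x y)"
  by (rule sweedler_apply[OF vs vs, where g = "\<lambda>u. z * u"]) (simp_all add: linear_simps)

lemma sweedler_scale:
  assumes "vector_space s3"
  shows "s3 c (sweedler h f) = sweedler h (\<lambda>x y. s3 c (f x y))"
proof -
  interpret s3: vector_space s3 by fact
  show ?thesis
    by (rule sweedler_apply[OF assms assms]) (simp_all add: s3.scale_right_distrib mult.commute)
qed

lemma sweedler_bilinear:
  assumes "vector_space s3" "bilinear s3 F"
  shows "F (sweedler h f) z = sweedler h (\<lambda>x y. F (f x y) z)"
    and "F z (sweedler h f) = sweedler h (\<lambda>x y. F z (f x y))"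
  by (rule sweedler_apply[OF vs assms(1)]; use assms(2) in \<open>simp add: bilinear_on_UNIV_iff\<close>)+

lemma sweedler_linear:
  assumes "vector_space s3" "bilinear s3 F"
  shows sweedler_add: "sweedler (x + y) F = sweedler x F + sweedler y F"
    and sweedler_scale_arg: "sweedler (s c x) F = s3 c (sweedler x F)"
  using tensor_universal_property(1)[OF vs vs assms(1) subspace_UNIV subspace_UNIV assms(2)]
    comult_in unfolding linear_on_def comult_add comult_scale by auto

lemma sweedler_sweedler:
  assumes "vector_space s3" "bilinear s3 F"
  shows "sweedler (sweedler h f) F = sweedler h (\<lambda>x y. sweedler (f x y) F)"
  by (rule sweedler_apply[OF vs assms(1)]) (simp_all add: sweedler_linear[OF assms])

text \<open>The linear map induced by \<open>F\<close> is applied to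
  \<open>\<Delta>(xy) = \<Delta>(x)\<Delta>(y)\<close> and moved through both sums to the pure
  tensors.\<close>

lemma sweedler_mult:
  assumes "vector_space s3" "bilinear s3 F"
  shows "sweedler (x * y) F = sweedler x (\<lambda>a b. sweedler y (\<lambda>c d. F (a * c) (b * d)))"
proof -
  note lin = tensor_universal_property(1,2)[OF vs vs assms(1) subspace_UNIV subspace_UNIV assms(2)]
  have "sweedler (x * y) F = tensor_lift s s UNIV UNIV F
     (sweedler x (\<lambda>a b. sweedler y (\<lambda>c d. tensor s s (a * c) (b * d))))"
    by (simp add: comult_mult tensor_mult_def)
  also have "\<dots> = sweedler x (\<lambda>a b. tensor_lift s s UNIV UNIV F
     (sweedler y (\<lambda>c d. tensor s s (a * c) (b * d))))"
    by (rule sweedler_apply_on[OF vsT assms(1) subspace_tensor_space lin(1)])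
       (rule tensor_lift_in[OF vs vs subspace_UNIV comult_in subspace_tensor_space vsT vsT, where g=id and B=UNIV],
        auto simp: linear_on_def tensor_in_tensor_space)
  also have "\<dots> = sweedler x (\<lambda>a b. sweedler y (\<lambda>c d. tensor_lift s s UNIV UNIV F (tensor s s (a * c) (b * d))))"
    by (subst sweedler_apply_on[OF vsT assms(1) subspace_tensor_space lin(1)])
       (auto simp: tensor_in_tensor_space)
  finally show ?thesis by (simp add: lin(2))
qed

lemma sweedler_in:
  assumes "vector_space sa" "module.subspace sa A" "\<And>x y. f x y \<in> A"
  shows "sweedler h f \<in> A"
  by (rule tensor_lift_in[OF vs vs subspace_UNIV comult_in assms(2,1,1), where g = id and B = UNIV])
     (auto simp: linear_on_def assms)

section \<open>Trilinear maps evaluated on \<open>H \<otimes> (H \<otimes> H)\<close>\<close>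

abbreviation HHH :: "('k, 'h, ('k, 'h, 'h) tensor) tensor set" where
  "HHH \<equiv> tensor_space s tensor_scale UNIV HH"

abbreviation mult3 :: "('k, 'h, ('k, 'h, 'h) tensor) tensor \<Rightarrow> ('k, 'h, ('k, 'h, 'h) tensor) tensor \<Rightarrow>
    ('k, 'h, ('k, 'h, 'h) tensor) tensor" where
  "mult3 \<equiv> tensor_mult s tensor_scale UNIV HH (*) (tensor_mult s s UNIV UNIV (*) (*))"

lemma bilinear_on_mult: "bilinear s (*)"
  by (simp add: bilinear_on_UNIV_iff linear_simps)

lemmas bilinear_on_mult2 =
  bilinear_on_tensor_mult[OF vs vs subspace_UNIV subspace_UNIV bilinear_on_mult bilinear_on_mult]

lemmas bilinear_on_mult3 =
  bilinear_on_tensor_mult[OF vs vsT subspace_UNIV subspace_tensor_space bilinear_on_mult bilinear_on_mult2]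

lemma mult3_tensor:
  "t \<in> HH \<Longrightarrow> u \<in> HH \<Longrightarrow>
    mult3 (tensor s tensor_scale x t) (tensor s tensor_scale y u) =
    tensor s tensor_scale (x * y) (tensor_mult s s UNIV UNIV (*) (*) t u)"
  by (rule tensor_mult_tensor[OF vs vsT subspace_UNIV subspace_tensor_space bilinear_on_mult bilinear_on_mult2])
     auto

lemma assoc_tensor:
  assumes "t \<in> HH"
  shows "tensor_assoc s s s UNIV UNIV UNIV (tensor tensor_scale s t z) =
    tensor_lift s s UNIV UNIV (\<lambda>x y. tensor s tensor_scale x (tensor s s y z)) t"
  unfolding tensor_assoc_def
  by (rule tensor_universal_property(2)[OF vsT vs vsT subspace_tensor_space subspace_UNIV
        bilinear_on_tensor_assoc[OF vs vs vs subspace_UNIV subspace_UNIV] assms UNIV_I])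

text \<open>For trilinear \<open>F\<close>, the induced linear map. Applied to coassociativity and
  to the axioms on \<open>\<Delta>(1)\<close>, it turns equations between tensors into equations
  between nested Sweedler sums.\<close>

abbreviation lift3 :: "('h \<Rightarrow> 'h \<Rightarrow> 'h \<Rightarrow> 'c::ab_group_add) \<Rightarrow> ('k, 'h, ('k, 'h, 'h) tensor) tensor \<Rightarrow> 'c" where
  "lift3 F \<equiv> tensor_lift s tensor_scale UNIV HH (\<lambda>x t. tensor_lift s s UNIV UNIV (F x) t)"

context
  fixes s3 :: "'k \<Rightarrow> 'c::ab_group_add \<Rightarrow> 'c" and F :: "'h \<Rightarrow> 'h \<Rightarrow> 'h \<Rightarrow> 'c"
  assumes vs3: "vector_space s3" and F: "trilinear s s3 F"
begin

lemma bilinear_lift3: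
  "bilinear_on s tensor_scale s3 UNIV HH (\<lambda>x t. tensor_lift s s UNIV UNIV (F x) t)"
  unfolding bilinear_on_def
proof (intro conjI ballI)
  fix t assume "t \<in> HH"
  then show "linear_on s s3 UNIV UNIV (\<lambda>x. tensor_lift s s UNIV UNIV (F x) t)"
    by (rule linear_on_tensor_lift_param[OF vs vs subspace_UNIV _ vs3])
       (use F in \<open>auto simp: trilinear_def bilinear_on_def\<close>)
next
  fix x show "linear_on tensor_scale s3 HH UNIV (tensor_lift s s UNIV UNIV (F x))"
    by (rule tensor_universal_property(1)[OF vs vs vs3 subspace_UNIV subspace_UNIV])
       (use F in \<open>simp add: trilinear_def\<close>)
qed

lemmas lift3 = tensor_universal_property(1,2)[OF vs vsT vs3 subspace_UNIV subspace_tensor_space bilinear_lift3]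

lemma lift3_sweedler:
  assumes "\<And>a b. f a b \<in> HHH"
  shows "lift3 F (sweedler h f) = sweedler h (\<lambda>a b. lift3 F (f a b))"
  by (rule sweedler_apply_on[OF vsT vs3 subspace_tensor_space lift3(1) assms])

lemma lift3_sweedler2:
  assumes "\<And>a b c d. f a b c d \<in> HHH"
  shows "lift3 F (sweedler h (\<lambda>a b. sweedler (k a b) (f a b))) =
    sweedler h (\<lambda>a b. sweedler (k a b) (\<lambda>c d. lift3 F (f a b c d)))"
  by (simp add: lift3_sweedler assms sweedler_in[OF vsT subspace_tensor_space])

lemma lift3_tensor: "u \<in> HH \<Longrightarrow> lift3 F (tensor s tensor_scale x u) = tensor_lift s s UNIV UNIV (F x) u"
  by (rule lift3(2)) auto

lemma lift3_tensor3: "lift3 F (tensor s tensor_scale x (tensor s s y z)) = F x y z"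
  using tensor_universal_property(2)[OF vs vs vs3 subspace_UNIV subspace_UNIV, of "F x" y z] F
  by (simp add: lift3_tensor tensor_in_tensor_space trilinear_def)

lemma lift3_tensor2:
  "tensor_lift s s UNIV UNIV (F x) (sweedler h (\<lambda>a b. tensor s s (f a b) (g a b))) =
    sweedler h (\<lambda>a b. F x (f a b) (g a b))"
proof -
  have "bilinear s3 (F x)" using F by (simp add: trilinear_def)
  note up = tensor_universal_property(1,2)[OF vs vs vs3 subspace_UNIV subspace_UNIV this]
  show ?thesis
    by (subst sweedler_apply_on[OF vsT vs3 subspace_tensor_space up(1)])
       (auto simp: up(2) tensor_in_tensor_space)
qed

text \<open>The associator is moved by linearity inside the outer sum, where it meets only
  \<open>\<Delta> a \<otimes> b\<close>. The tensor treated here is the common left-hand side of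
  coassociativity and of both axioms on \<open>\<Delta>(1)\<close>.\<close>

lemma lift3_comult_left:
  "lift3 F (tensor_assoc s s s UNIV UNIV UNIV (tensor_map s s tensor_scale s UNIV UNIV \<Delta> id (\<Delta> h))) =
    sweedler h (\<lambda>a b. sweedler a (\<lambda>c d. F c d b))"
proof -
  have "tensor_assoc s s s UNIV UNIV UNIV (tensor_map s s tensor_scale s UNIV UNIV \<Delta> id (\<Delta> h)) =
     sweedler h (\<lambda>a b. tensor_assoc s s s UNIV UNIV UNIV (tensor tensor_scale s (\<Delta> a) b))"
    unfolding tensor_map_def id_def
    by (rule sweedler_apply_on[OF vsT vsT subspace_tensor_space])
       (auto simp: tensor_assoc_def tensor_in_tensor_space comult_in intro!:
         tensor_universal_property(1)[OF vsT vs vsT subspace_tensor_space subspace_UNIV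
           bilinear_on_tensor_assoc[OF vs vs vs subspace_UNIV subspace_UNIV]])
  then show ?thesis
    by (simp add: assoc_tensor comult_in lift3_sweedler2 lift3_tensor3 tensor_in_tensor_space)
qed

lemma sweedler_coassoc:
  "sweedler h (\<lambda>a b. sweedler a (\<lambda>c d. F c d b)) = sweedler h (\<lambda>a b. sweedler b (\<lambda>c d. F a c d))"
  using coassoc[of h] lift3_comult_left[of h]
  by (simp add: tensor_map_def lift3_sweedler lift3_tensor tensor_in_tensor_space comult_in)

text \<open>\<open>\<Delta>(1) \<otimes> 1\<close> is expanded into pure tensors and each is
  multiplied factorwise with \<open>1 \<otimes> \<Delta>(1)\<close>, so that the right-hand side is
  \<open>1\<^sub>1 \<otimes> 1\<^sub>21'\<^sub>1 \<otimes> 1'\<^sub>2\<close> under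
  \<open>F\<close>.\<close>

lemma sweedler_one1:
  "sweedler 1 (\<lambda>a b. sweedler a (\<lambda>c d. F c d b)) = sweedler 1 (\<lambda>a b. sweedler 1 (\<lambda>c d. F a (b * c) d))"
proof -
  have "tensor_assoc s s s UNIV UNIV UNIV (tensor_map s s tensor_scale s UNIV UNIV \<Delta> id (\<Delta> 1)) =
     sweedler 1 (\<lambda>a b. mult3 (tensor s tensor_scale a (tensor s s b 1)) (tensor s tensor_scale 1 (\<Delta> 1)))"
    unfolding comult_one1 assoc_tensor[OF comult_in]
    by (rule sweedler_apply_on[where A = HHH and B = UNIV, OF vsT vsT subspace_tensor_space])
       (use bilinear_on_mult3 in \<open>auto simp: bilinear_on_def tensor_in_tensor_space comult_in\<close>)
  also have "\<dots> = sweedler 1 (\<lambda>a b. tensor s tensor_scale a (sweedler 1 (\<lambda>c d. tensor s s (b * c) d)))"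
    by (simp add: mult3_tensor tensor_in_tensor_space comult_in
        tensor_mult_tensor_left[OF vs vs subspace_UNIV subspace_UNIV bilinear_on_mult bilinear_on_mult])
  finally show ?thesis
    unfolding lift3_comult_left[symmetric]
    by (simp add: lift3_sweedler lift3_tensor lift3_tensor2 tensor_in_tensor_space
        sweedler_in[OF vsT subspace_tensor_space])
qed

text \<open>The opposite order of the two factors gives the middle leg
  \<open>1'\<^sub>11\<^sub>2\<close>. Having both orders is what allows elements of
  \<open>H\<^sup>L\<close> on either side in \<open>sweedler_sqcap_L\<close>.\<close>

lemma sweedler_one2:
  "sweedler 1 (\<lambda>a b. sweedler a (\<lambda>c d. F c d b)) = sweedler 1 (\<lambda>a b. sweedler 1 (\<lambda>c d. F a (c * b) d))"
proof -
  have "tensor_assoc s s s UNIV UNIV UNIV (tensor_map s s tensor_scale s UNIV UNIV \<Delta> id (\<Delta> 1)) =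
     sweedler 1 (\<lambda>a b. mult3 (tensor s tensor_scale 1 (\<Delta> 1)) (tensor s tensor_scale a (tensor s s b 1)))"
    unfolding comult_one2 assoc_tensor[OF comult_in]
    by (rule sweedler_apply_on[where A = HHH and B = UNIV, OF vsT vsT subspace_tensor_space])
       (use bilinear_on_mult3 in \<open>auto simp: bilinear_on_def tensor_in_tensor_space comult_in\<close>)
  also have "\<dots> = sweedler 1 (\<lambda>a b. tensor s tensor_scale a (sweedler 1 (\<lambda>c d. tensor s s (c * b) d)))"
    by (simp add: mult3_tensor tensor_in_tensor_space comult_in
        tensor_mult_tensor_right[OF vs vs subspace_UNIV subspace_UNIV bilinear_on_mult bilinear_on_mult])
  finally show ?thesis
    unfolding lift3_comult_left[symmetric]
    by (simp add: lift3_sweedler lift3_tensor lift3_tensor2 tensor_in_tensor_space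
        sweedler_in[OF vsT subspace_tensor_space])
qed

end


section \<open>The operators \<open>\<sqinter>\<^sup>L\<close> and \<open>\<sqinter>\<^sup>R\<close>\<close>

abbreviation L :: "'h \<Rightarrow> 'h" where "L \<equiv> sqcap_L s \<Delta> \<epsilon>"
abbreviation R :: "'h \<Rightarrow> 'h" where "R \<equiv> sqcap_R s \<Delta> \<epsilon>"
abbreviation HL :: "'h set" where "HL \<equiv> base_L s \<Delta> \<epsilon>"
abbreviation HR :: "'h set" where "HR \<equiv> base_R s \<Delta> \<epsilon>"

text \<open>The variant of \<open>L\<close> with \<open>h\<close> to the left of
  \<open>1\<^sub>1\<close>. It appears in the separability argument once the two copies of
  \<open>\<Delta>(1)\<close> are exchanged; its right \<open>H\<^sup>L\<close>-linearity is what
  carries \<open>t\<close> across.\<close>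

definition sqcap_L' :: "'h \<Rightarrow> 'h" where
  "sqcap_L' h = sweedler 1 (\<lambda>a b. s (\<epsilon> (h * a)) b)"

lemma sqcap_L_linear: "L (x + y) = L x + L y" "L (s c x) = s c (L x)"
  by (simp_all add: sqcap_L_def linear_simps tensor_lift_add sweedler_scale[OF vs])

lemma sqcap_R_linear: "R (x + y) = R x + R y" "R (s c x) = s c (R x)"
  by (simp_all add: sqcap_R_def linear_simps tensor_lift_add sweedler_scale[OF vs])

text \<open>The second counit axiom with middle factor \<open>1\<close> reads \<open>\<epsilon>(xy)
  = \<epsilon>(x1\<^sub>2)\<epsilon>(1\<^sub>1y)\<close>, and the right-hand side collects to
  \<open>\<epsilon>(x L(y))\<close>.\<close>

lemma counit_mult_sqcap_L: "\<epsilon> (x * L y) = \<epsilon> (x * y)"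
  using counit_mult2[of x 1 y]
  by (simp add: sqcap_L_def sweedler_mult_left sweedler_counit linear_simps mult.commute)

lemma sqcap_L_mult_sqcap_L: "L (x * L y) = L (x * y)"
  using counit_mult_sqcap_L by (simp add: sqcap_L_def[of s \<Delta> \<epsilon> "x * _"] mult.assoc[symmetric])

lemma sqcap_L_idem: "x \<in> HL \<Longrightarrow> L x = x"
  using sqcap_L_mult_sqcap_L[of 1] by (auto simp: base_L_def)

lemma sqcap_L_in: "L x \<in> HL"
  by (simp add: base_L_def)

lemma sqcap_R_in: "R x \<in> HR"
  by (simp add: base_R_def)

lemma sqcap_R_one: "R 1 = 1"
  using counit_right[of 1] by (simp add: sqcap_R_def)

section \<open>Consequences of the axiom on \<open>\<Delta>(1)\<close>\<close>

context
  fixes s3 :: "'k \<Rightarrow> 'c::ab_group_add \<Rightarrow> 'c" and F :: "'h \<Rightarrow> 'h \<Rightarrow> 'c"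
  assumes vs3: "vector_space s3" and F: "bilinear s3 F"
begin

interpretation s3: vector_space s3 by (rule vs3)

lemmas F_simps = F[unfolded bilinear_on_UNIV_iff, rule_format]

text \<open>Apply \<open>id \<otimes> \<epsilon> \<otimes> id\<close> to \<open>1\<^sub>1 \<otimes>
  1'\<^sub>11\<^sub>2 \<otimes> 1'\<^sub>2 = (\<Delta> \<otimes> id)\<Delta>(1)\<close> and cancel
  the counit.\<close>

lemma sweedler_one_counit:
  "sweedler 1 (\<lambda>a b. sweedler 1 (\<lambda>c d. s3 (\<epsilon> (c * b)) (F a d))) = sweedler 1 F"
proof -
  have "sweedler 1 (\<lambda>a b. sweedler 1 (\<lambda>c d. s3 (\<epsilon> (c * b)) (F a d))) =
     sweedler 1 (\<lambda>a b. sweedler a (\<lambda>c d. s3 (\<epsilon> d) (F c b)))"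
    by (rule sweedler_one2[OF vs3, of "\<lambda>a c d. s3 (\<epsilon> c) (F a d)", symmetric])
       (simp add: trilinear_def bilinear_on_UNIV_iff F_simps linear_simps s3.scale_right_distrib
         s3.scale_left_distrib mult.commute)
  also have "\<dots> = sweedler 1 (\<lambda>a b. F (sweedler a (\<lambda>c d. s (\<epsilon> d) c)) b)"
    by (simp add: sweedler_bilinear[OF vs3 F] F_simps)
  finally show ?thesis by (simp add: counit_right)
qed

lemma sweedler_one_sqcap_L: "sweedler 1 (\<lambda>a b. F a (L b)) = sweedler 1 F"
  by (simp add: sqcap_L_def sweedler_bilinear[OF vs3 F] F_simps sweedler_one_counit)

text \<open>Expanding \<open>R\<close> gives the double sum of \<open>sweedler_one_counit\<close>
  with the two copies of \<open>\<Delta>(1)\<close> interchanged.\<close>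

lemma sweedler_one_sqcap_R: "sweedler 1 (\<lambda>a b. F (R a) b) = sweedler 1 F"
proof -
  have "sweedler 1 (\<lambda>a b. F (R a) b) = sweedler 1 (\<lambda>a b. sweedler 1 (\<lambda>c d. s3 (\<epsilon> (a * d)) (F c b)))"
    by (simp add: sqcap_R_def sweedler_bilinear[OF vs3 F] F_simps)
  also have "\<dots> = sweedler 1 F"
    by (subst tensor_lift_swap) (rule sweedler_one_counit)
  finally show ?thesis .
qed

text \<open>Coassociativity turns \<open>\<Delta>(L h)\<close> into
  \<open>\<epsilon>(1\<^sub>1h)1\<^sub>2 \<otimes> 1\<^sub>3\<close>. The two factorisations of the
  threefold coproduct of \<open>1\<close> then put \<open>L h\<close> on the left or on the right of
  the first leg.\<close>

lemma sweedler_sqcap_L: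
  "sweedler (L h) F = sweedler 1 (\<lambda>a b. F (L h * a) b)" (is ?thesis1)
  "sweedler (L h) F = sweedler 1 (\<lambda>a b. F (a * L h) b)" (is ?thesis2)
proof -
  have tri: "trilinear s s3 (\<lambda>a c d. s3 (\<epsilon> (a * h)) (F c d))"
    by (simp add: trilinear_def bilinear_on_UNIV_iff F_simps linear_simps s3.scale_right_distrib
         s3.scale_left_distrib mult.commute)
  have "sweedler (L h) F = sweedler 1 (\<lambda>a b. sweedler b (\<lambda>c d. s3 (\<epsilon> (a * h)) (F c d)))"
    by (simp add: sqcap_L_def sweedler_sweedler[OF vs3 F] sweedler_scale_arg[OF vs3 F] sweedler_scale[OF vs3])
  also have "\<dots> = sweedler 1 (\<lambda>a b. sweedler a (\<lambda>c d. s3 (\<epsilon> (c * h)) (F d b)))"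
    by (rule sweedler_coassoc[OF vs3 tri, symmetric])
  finally have eq: "sweedler (L h) F = \<dots>" .
  have "\<dots> = sweedler 1 (\<lambda>c d. sweedler 1 (\<lambda>a b. s3 (\<epsilon> (a * h)) (F (b * c) d)))"
    by (subst sweedler_one1[OF vs3 tri]) (rule tensor_lift_swap)
  with eq show ?thesis1
    by (simp add: sqcap_L_def sweedler_mult_right sweedler_bilinear[OF vs3 F] F_simps linear_simps)
  have "sweedler 1 (\<lambda>a b. sweedler a (\<lambda>c d. s3 (\<epsilon> (c * h)) (F d b))) =
     sweedler 1 (\<lambda>c d. sweedler 1 (\<lambda>a b. s3 (\<epsilon> (a * h)) (F (c * b) d)))"
    by (subst sweedler_one2[OF vs3 tri]) (rule tensor_lift_swap)
  with eq show ?thesis2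
    by (simp add: sqcap_L_def sweedler_mult_left sweedler_bilinear[OF vs3 F] F_simps linear_simps)
qed

text \<open>Here the last leg of
  \<open>1\<^sub>1 \<otimes> 1\<^sub>21'\<^sub>1 \<otimes> 1'\<^sub>2\<close> is fed to
  \<open>\<epsilon>(h -)\<close>, which collects \<open>1'\<^sub>1\<close> into
  \<open>R h\<close>.\<close>

lemma sweedler_sqcap_R: "sweedler (R h) F = sweedler 1 (\<lambda>a b. F a (b * R h))"
proof -
  have tri: "trilinear s s3 (\<lambda>c d b. s3 (\<epsilon> (h * b)) (F c d))"
    by (simp add: trilinear_def bilinear_on_UNIV_iff F_simps linear_simps s3.scale_right_distrib
         s3.scale_left_distrib mult.commute)
  have "sweedler (R h) F = sweedler 1 (\<lambda>a b. sweedler a (\<lambda>c d. s3 (\<epsilon> (h * b)) (F c d)))"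
    by (simp add: sqcap_R_def sweedler_sweedler[OF vs3 F] sweedler_scale_arg[OF vs3 F] sweedler_scale[OF vs3])
  also have "\<dots> = sweedler 1 (\<lambda>a b. sweedler 1 (\<lambda>c d. s3 (\<epsilon> (h * d)) (F a (b * c))))"
    by (rule sweedler_one1[OF vs3 tri])
  finally show ?thesis
    by (simp add: sqcap_R_def sweedler_mult_left sweedler_bilinear[OF vs3 F] F_simps linear_simps)
qed

lemma sweedler_HL:
  assumes "x \<in> HL"
  shows "sweedler x F = sweedler 1 (\<lambda>a b. F (x * a) b)"
    and "sweedler x F = sweedler 1 (\<lambda>a b. F (a * x) b)"
  using assms sweedler_sqcap_L by (auto simp: base_L_def)

lemma sweedler_HR: "y \<in> HR \<Longrightarrow> sweedler y F = sweedler 1 (\<lambda>a b. F a (b * y))"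
  using sweedler_sqcap_R by (auto simp: base_R_def)

end

text \<open>\<open>\<Delta>(x)\<Delta>(y) = \<Delta>(x)\<Delta>(1)(1 \<otimes> y) = \<Delta>(x)(1
  \<otimes> y)\<close>, into which the formula for \<open>\<Delta>(x)\<close> is inserted.\<close>

lemma sweedler_HL_mult_HR:
  assumes vs3: "vector_space s3" and F: "bilinear s3 F" and x: "x \<in> HL" and y: "y \<in> HR"
  shows "sweedler (x * y) F = sweedler 1 (\<lambda>a b. F (x * a) (b * y))"
proof -
  note F_simps = F[unfolded bilinear_on_UNIV_iff, rule_format]
  have "sweedler (x * y) F = sweedler x (\<lambda>a b. sweedler 1 (\<lambda>c d. F (a * c) (b * (d * y))))"
    unfolding sweedler_mult[OF vs3 F]
    by (subst sweedler_HR[OF vs3 _ y])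
       (simp_all add: bilinear_on_UNIV_iff F_simps linear_simps)
  \<comment> \<open>The copy of \<open>\<Delta>(1)\<close> coming from \<open>y\<close> is absorbed
    by reading \<open>x\<close> as \<open>x * 1\<close>.\<close>
  also have "\<dots> = sweedler (x * 1) (\<lambda>a b. F a (b * y))"
    by (subst sweedler_mult[OF vs3]) (simp_all add: bilinear_on_UNIV_iff F_simps linear_simps mult.assoc)
  also have "\<dots> = sweedler 1 (\<lambda>a b. F (x * a) (b * y))"
    using x by (simp add: sweedler_HL(1)[OF vs3] bilinear_on_UNIV_iff F_simps linear_simps)
  finally show ?thesis .
qed

text \<open>
  An element \<open>z\<close> with \<open>\<Delta>(z) = 1\<^sub>1z \<otimes> 1\<^sub>2\<close> lies in \<open>H\<^sup>L\<close>: apply \<open>\<epsilon> \<otimes> id\<close>. This condition is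
  closed under products.
\<close>

lemma HL_mult:
  assumes "x \<in> HL" "y \<in> HL"
  shows "x * y \<in> HL"
proof -
  let ?F = "\<lambda>a b. s (\<epsilon> a) b"
  have F: "bilinear s ?F" "bilinear s (\<lambda>a b. s (\<epsilon> (a * y)) b)" for y
    by (simp_all add: bilinear_on_UNIV_iff linear_simps mult.commute)
  have "x * y = sweedler (x * y) ?F" by (simp add: counit_left)
  also have "\<dots> = sweedler x (\<lambda>a b. sweedler y (\<lambda>c d. ?F (a * c) (b * d)))"
    by (rule sweedler_mult[OF vs F(1)])
  also have "\<dots> = sweedler x (\<lambda>a b. sweedler 1 (\<lambda>c d. ?F (a * (c * y)) (b * d)))"
    by (subst sweedler_HL(2)[OF vs _ assms(2)])
       (simp_all add: bilinear_on_UNIV_iff linear_simps mult.commute)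
  also have "\<dots> = sweedler (x * 1) (\<lambda>a b. ?F (a * y) b)"
    by (subst sweedler_mult[OF vs F(2)]) (simp add: mult.assoc)
  also have "\<dots> = L (x * y)"
    using sweedler_HL(2)[OF vs F(2) assms(1)] by (simp add: sqcap_L_def mult.assoc)
  finally show ?thesis using sqcap_L_in by metis
qed

text \<open>\<open>L(xh) = L(x L(h))\<close>, and \<open>x L(h)\<close> lies in
  \<open>H\<^sup>L\<close>, where \<open>L\<close> is the identity.\<close>

lemma sqcap_L_mult_left: "x \<in> HL \<Longrightarrow> L (x * h) = x * L h"
  using sqcap_L_mult_sqcap_L[of x h] sqcap_L_idem HL_mult sqcap_L_in by metis

text \<open>The product \<open>sqcap_L' h * t\<close> lies in \<open>H\<^sup>L\<close>, hence is
  fixed by \<open>sqcap_L'\<close>. On the other hand the counit does not distinguish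
  \<open>sqcap_L' h\<close> from \<open>h\<close> as a left factor, so the image of this product
  under \<open>sqcap_L'\<close> is \<open>sqcap_L' (h * t)\<close>.\<close>

lemma sqcap_L'_mult_HL:
  assumes "t \<in> HL"
  shows "sqcap_L' (h * t) = sqcap_L' h * t"
proof -
  have bil: "bilinear s (\<lambda>a b. s (\<epsilon> (h * a)) b)" for h
    by (simp add: bilinear_on_UNIV_iff linear_simps mult.commute)
  have id: "sqcap_L' t = t" if "t \<in> HL" for t
  proof -
    have "sqcap_L' t = sweedler t (\<lambda>a b. s (\<epsilon> a) b)"
      unfolding sqcap_L'_def
      by (rule sweedler_HL(1)[OF vs _ that, symmetric]) (use bil[of 1] in simp)
    then show ?thesis by (simp add: counit_left)
  qed
  have "L (sqcap_L' h) = sqcap_L' h"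
  proof -
    have "L (sqcap_L' h) = sweedler 1 (\<lambda>a b. s (\<epsilon> (h * a)) (L b))"
      unfolding sqcap_L'_def
      by (subst sweedler_apply[OF vs vs, where g = L]) (simp_all add: sqcap_L_linear)
    also have "\<dots> = sqcap_L' h"
      unfolding sqcap_L'_def by (rule sweedler_one_sqcap_L[OF vs bil])
    finally show ?thesis .
  qed
  then have "sqcap_L' h \<in> HL" using sqcap_L_in by metis
  then have "sqcap_L' (sqcap_L' h * t) = sqcap_L' h * t" using HL_mult assms id by blast
  \<comment> \<open>The first counit axiom with middle factor \<open>1\<close>:
    \<open>\<epsilon>(hu) = \<epsilon>(h1\<^sub>1)\<epsilon>(1\<^sub>2u)\<close>.\<close>
  moreover have "\<epsilon> (sqcap_L' h * u) = \<epsilon> (h * u)" for u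
    using counit_mult1[of h 1 u]
    by (simp add: sqcap_L'_def sweedler_mult_right sweedler_counit linear_simps)
  then have "sqcap_L' (sqcap_L' h * t) = sqcap_L' (h * t)"
    by (simp add: sqcap_L'_def[of "_ * t"] mult.assoc)
  ultimately show ?thesis by simp
qed

text \<open>With \<open>L(1\<^sub>1) = \<epsilon>(1'\<^sub>11\<^sub>1)1'\<^sub>2\<close>, summing
  over the unprimed copy first yields \<open>1'\<^sub>2 \<otimes> sqcap_L'(1'\<^sub>1)t\<close>.
  Right linearity moves \<open>t\<close> inside \<open>sqcap_L'\<close>, and summing over the primed
  copy first then gives \<open>L(t1\<^sub>1) \<otimes> 1\<^sub>2\<close>.\<close>

lemma separability_idempotent:
  assumes vs3: "vector_space s3" and F: "bilinear s3 F" and t: "t \<in> HL"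
  shows "sweedler 1 (\<lambda>a b. F (L a) (b * t)) = sweedler 1 (\<lambda>a b. F (t * L a) b)"
proof -
  note F_simps = F[unfolded bilinear_on_UNIV_iff, rule_format]
  have "sweedler 1 (\<lambda>a b. F (L a) (b * t)) =
     sweedler 1 (\<lambda>a b. sweedler 1 (\<lambda>c d. s3 (\<epsilon> (c * a)) (F d (b * t))))"
    by (simp add: sqcap_L_def sweedler_bilinear[OF vs3 F] F_simps)
  also have "\<dots> = sweedler 1 (\<lambda>c d. F d (sqcap_L' c * t))"
    by (subst tensor_lift_swap)
       (simp add: sqcap_L'_def sweedler_mult_right sweedler_bilinear[OF vs3 F] F_simps linear_simps)
  also have "\<dots> = sweedler 1 (\<lambda>c d. sweedler 1 (\<lambda>a b. s3 (\<epsilon> (c * (t * a))) (F d b)))"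
    unfolding sqcap_L'_mult_HL[OF t, symmetric]
    by (simp add: sqcap_L'_def sweedler_bilinear[OF vs3 F] F_simps mult.assoc)
  also have "\<dots> = sweedler 1 (\<lambda>a b. F (L (t * a)) b)"
  proof (subst tensor_lift_swap)
    have "sweedler 1 (\<lambda>c d. s3 (\<epsilon> (c * (t * a))) (F d b)) = F (L (t * a)) b" for a b
      by (simp add: sqcap_L_def sweedler_bilinear[OF vs3 F] F_simps)
    then show "sweedler 1 (\<lambda>a b. sweedler 1 (\<lambda>c d. s3 (\<epsilon> (c * (t * a))) (F d b))) =
        sweedler 1 (\<lambda>a b. F (L (t * a)) b)" by simp
  qed
  finally show ?thesis by (simp add: sqcap_L_mult_left[OF t])
qed

lemma paired_identity_generator:
  assumes x: "x \<in> HL" and y: "y \<in> HR"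
  shows "sweedler (x * y) (\<lambda>a b. tensor s s (L a) (L b)) =
     sweedler (L (x * y)) (\<lambda>a b. tensor s s (L a) b) + sweedler (L (x * y)) (\<lambda>a b. tensor s s a (L b)) +
     tensor_scale (-1) (\<Delta> (L (x * y)))"
proof -
  note bil = bilinear_on_UNIV_iff tensor_linear sqcap_L_linear linear_simps
  define t where "t = L y"
  have t: "t \<in> HL" "x * t \<in> HL" using x by (auto simp: t_def sqcap_L_in HL_mult)
  have Lxy: "L (x * y) = x * t" by (simp add: t_def sqcap_L_mult_left x)
  have "sweedler (x * y) (\<lambda>a b. tensor s s (L a) (L b)) =
      sweedler 1 (\<lambda>a b. tensor s s (x * L a) (L (b * y)))"
    by (subst sweedler_HL_mult_HR[OF vsT _ x y]) (simp_all add: bil sqcap_L_mult_left x)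
  \<comment> \<open>\<open>L\<close> is inserted on the second leg to bring it into
    \<open>H\<^sup>L\<close>, so that left linearity splits off \<open>t = L y\<close>; afterwards
    it is removed again.\<close>
  also have "\<dots> = sweedler 1 (\<lambda>a b. tensor s s (x * L a) (L (L b * y)))"
    by (rule sweedler_one_sqcap_L[OF vsT, symmetric]) (simp add: bil)
  also have "\<dots> = sweedler 1 (\<lambda>a b. tensor s s (x * L a) (L b * t))"
    by (simp add: sqcap_L_mult_left sqcap_L_in t_def)
  also have "\<dots> = sweedler 1 (\<lambda>a b. tensor s s (x * L a) (b * t))"
    by (rule sweedler_one_sqcap_L[OF vsT]) (simp add: bil)
  \<comment> \<open>The separability idempotent carries \<open>t\<close> from the second leg to the
    first.\<close>
  also have "\<dots> = sweedler 1 (\<lambda>a b. tensor s s (x * (t * L a)) b)"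
    by (rule separability_idempotent[OF vsT _ t(1)]) (simp add: bil)
  also have "\<dots> = sweedler (x * t) (\<lambda>a b. tensor s s (L a) b)"
    by (subst sweedler_HL(1)[OF vsT _ t(2)]) (simp_all add: bil sqcap_L_mult_left[OF t(2)], simp add: mult.assoc)
  finally have 1: "sweedler (x * y) (\<lambda>a b. tensor s s (L a) (L b)) = \<dots>" .
  \<comment> \<open>The remaining two terms cancel at weight \<open>-1\<close>: on
    \<open>\<Delta>(xt) = xt1\<^sub>1 \<otimes> 1\<^sub>2\<close> the operator
    \<open>id \<otimes> L\<close> acts as the identity.\<close>
  have "sweedler (x * t) (\<lambda>a b. tensor s s a (L b)) = sweedler 1 (\<lambda>a b. tensor s s (x * t * a) (L b))"
    by (rule sweedler_HL(1)[OF vsT _ t(2)]) (simp add: bil)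
  also have "\<dots> = sweedler 1 (\<lambda>a b. tensor s s (x * t * a) b)"
    by (rule sweedler_one_sqcap_L[OF vsT]) (simp add: bil)
  also have "\<dots> = sweedler (x * t) (tensor s s)"
    by (rule sweedler_HL(1)[OF vsT _ t(2), symmetric]) (simp add: bil)
  finally have "sweedler (x * t) (\<lambda>a b. tensor s s a (L b)) = \<Delta> (x * t)"
    by (simp add: sweedler_tensor)
  with 1 show ?thesis by (simp add: Lxy tensor_scale_def fun_eq_iff)
qed

section \<open>The subcoalgebra \<open>H\<^sup>L H\<^sup>R\<close>\<close>

abbreviation HLR :: "'h set" where "HLR \<equiv> base_LR s \<Delta> \<epsilon>"

lemma HLR_mult: "x \<in> HL \<Longrightarrow> y \<in> HR \<Longrightarrow> x * y \<in> HLR"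
  unfolding base_LR_def by (rule span_base) auto

lemma subspace_HLR: "subspace HLR"
  unfolding base_LR_def by simp

lemma HLR_induct [consumes 1, case_names zero add]:
  assumes "m \<in> HLR" "P 0"
    and "\<And>c x y m. x \<in> HL \<Longrightarrow> y \<in> HR \<Longrightarrow> m \<in> HLR \<Longrightarrow> P m \<Longrightarrow> P (s c (x * y) + m)"
  shows "P m"
proof -
  have "m \<in> HLR \<and> P m"
    using assms(1) unfolding base_LR_def
    by (induction rule: span_induct_alt)
       (auto simp: base_LR_def[symmetric] subspace_0[OF subspace_HLR] subspace_add[OF subspace_HLR]
         subspace_scale[OF subspace_HLR] HLR_mult assms(2,3))
  then show ?thesis by simp
qed

text \<open>Both sides are linear in \<open>m\<close>, so the identity extends from the products
  spanning \<open>H\<^sup>LH\<^sup>R\<close>.\<close>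

lemma paired_identity_HLR:
  assumes "m \<in> HLR"
  shows "sweedler m (\<lambda>a b. tensor s s (L a) (L b)) =
     sweedler (L m) (\<lambda>a b. tensor s s (L a) b) + sweedler (L m) (\<lambda>a b. tensor s s a (L b)) +
     tensor_scale (-1) (\<Delta> (L m))"
proof -
  interpret T: vector_space "tensor_scale :: 'k \<Rightarrow> ('k, 'h, 'h) tensor \<Rightarrow> _" by (rule vsT)
  note bil = bilinear_on_UNIV_iff tensor_linear sqcap_L_linear linear_simps
  have b: "bilinear tensor_scale (\<lambda>a b. tensor s s (L a) (L b))"
    "bilinear tensor_scale (\<lambda>a b. tensor s s (L a) b)"
    "bilinear tensor_scale (\<lambda>a b. tensor s s a (L b))"
    by (simp_all add: bil)
  note lin = b[THEN sweedler_add[OF vsT]] b[THEN sweedler_scale_arg[OF vsT]]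
  from assms show ?thesis
  proof (induction rule: HLR_induct)
    case zero
    show ?case
      using lin(4-6)[of 0 0] sqcap_L_linear(2)[of 0 0] comult_scale[of 0 0]
      by (simp only: scale_zero_left T.scale_zero_left T.scale_zero_right add_0_left)
  next
    case (add c x y m)
    show ?case
      by (simp only: lin sqcap_L_linear add.IH paired_identity_generator[OF add.hyps(1,2)])
         (simp only: comult_add comult_scale T.scale_right_distrib T.scale_left_commute[of "-1" c] ac_simps)
  qed
qed

text \<open>Values of \<open>L\<close> lie in \<open>H\<^sup>L\<close>, which is contained in
  \<open>H\<^sup>LH\<^sup>R\<close> because \<open>1 = R 1\<close> belongs to
  \<open>H\<^sup>R\<close>.\<close>

lemma sqcap_L_HLR: "m \<in> HLR \<Longrightarrow> L m \<in> HLR"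
proof (induction rule: HLR_induct)
  case zero
  show ?case using sqcap_L_linear(2)[of 0 0] subspace_0[OF subspace_HLR] by simp
next
  case (add c x y m)
  have "(1 :: 'h) \<in> HR" using sqcap_R_in[of 1] by (simp add: sqcap_R_one)
  then have "L (x * y) \<in> HLR" using HLR_mult[OF sqcap_L_in, of 1] by simp
  with add show ?case
    by (simp add: sqcap_L_linear subspace_add[OF subspace_HLR] subspace_scale[OF subspace_HLR])
qed

text \<open>Inserting \<open>R\<close> on the first and \<open>L\<close> on the second leg of
  \<open>\<Delta>(1)\<close> gives
  \<open>\<Delta>(xy) = x R(1\<^sub>1) \<otimes> L(1\<^sub>2)y\<close>, where each leg is a product
  of an element of \<open>H\<^sup>L\<close> and one of \<open>H\<^sup>R\<close>.\<close>

lemma comult_HLR: "m \<in> HLR \<Longrightarrow> \<Delta> m \<in> tensor_space s s HLR HLR"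
proof (induction rule: HLR_induct)
  case zero
  show ?case using comult_scale[of 0 0] module.subspace_0[OF module_tensor_scale subspace_tensor_space]
    by (simp add: tensor_scale_def zero_fun_def)
next
  case (add c x y m)
  note bil = bilinear_on_UNIV_iff tensor_linear sqcap_L_linear sqcap_R_linear linear_simps
  have "\<Delta> (x * y) = sweedler 1 (\<lambda>a b. tensor s s (x * a) (b * y))"
    using sweedler_HL_mult_HR[OF vsT _ add.hyps(1,2), of "tensor s s"] by (simp add: sweedler_tensor bil)
  also have "\<dots> = sweedler 1 (\<lambda>a b. tensor s s (x * R a) (b * y))"
    by (rule sweedler_one_sqcap_R[OF vsT, symmetric]) (simp add: bil)
  also have "\<dots> = sweedler 1 (\<lambda>a b. tensor s s (x * R a) (L b * y))"
    by (rule sweedler_one_sqcap_L[OF vsT, symmetric]) (simp add: bil)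
  also have "\<dots> \<in> tensor_space s s HLR HLR"
    by (rule sweedler_in[OF vsT subspace_tensor_space])
       (intro tensor_in_tensor_space HLR_mult add.hyps sqcap_L_in sqcap_R_in)
  finally show ?case
    unfolding comult_add comult_scale
    by (intro add.IH module.subspace_add[OF module_tensor_scale subspace_tensor_space]
        module.subspace_scale[OF module_tensor_scale subspace_tensor_space])
qed

lemma linear_on_comult: "linear_on s tensor_scale V UNIV \<Delta>"
  by (simp add: linear_on_def comult_add comult_scale)

lemma linear_on_sqcap_L: "linear_on s s V UNIV L"
  by (simp add: linear_on_def sqcap_L_linear)

lemma linear_on_id: "linear_on s s V UNIV id"
  by (simp add: linear_on_def)

section \<open>Restriction of the coalgebra axioms to subspaces\<close>

context
  fixes U M m
  assumes U: "subspace U" and M: "subspace M" and m: "\<Delta> m \<in> tensor_space s s U M"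
begin

text \<open>Each map over the small carriers is replaced by the one over all of \<open>H\<close>,
  where coassociativity holds, and the result is carried back. With
  \<open>M = H\<^sup>LH\<^sup>R\<close>, the choice \<open>U = H\<close> serves the comodule and
  \<open>U = M\<close> the subcoalgebra.\<close>

lemma coassoc_restrict:
  assumes "\<And>x. x \<in> U \<Longrightarrow> \<Delta> x \<in> tensor_space s s U U"
  shows "tensor_assoc s s s U U M (tensor_map s s tensor_scale s U M \<Delta> id (\<Delta> m)) =
    tensor_map s s s tensor_scale U M id \<Delta> (\<Delta> m)"
proof -
  have "tensor_map s s tensor_scale s U M \<Delta> id (\<Delta> m) \<in>
      tensor_space tensor_scale s (tensor_space s s U U) M"
    unfolding tensor_map_def
    by (rule tensor_lift_in[OF vs vs U m subspace_tensor_space vsT vsT, where g = id and B = UNIV])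
       (auto simp: linear_on_def assms tensor_in_tensor_space)
  then have "tensor_assoc s s s U U M (tensor_map s s tensor_scale s U M \<Delta> id (\<Delta> m)) =
      tensor_assoc s s s UNIV UNIV UNIV (tensor_map s s tensor_scale s U M \<Delta> id (\<Delta> m))"
    by (intro tensor_assoc_restrict vs U subspace_UNIV) auto
  moreover have "tensor_map s s tensor_scale s U M \<Delta> id (\<Delta> m) =
      tensor_map s s tensor_scale s UNIV UNIV \<Delta> id (\<Delta> m)"
    by (rule tensor_map_restrict[OF vs vs vsT vs U subspace_UNIV subspace_UNIV
          linear_on_comult linear_on_id _ _ m]) auto
  ultimately have "tensor_assoc s s s U U M (tensor_map s s tensor_scale s U M \<Delta> id (\<Delta> m)) =
      tensor_map s s s tensor_scale UNIV UNIV id \<Delta> (\<Delta> m)"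
    by (metis coassoc UNIV_I)
  also have "\<dots> = tensor_map s s s tensor_scale U M id \<Delta> (\<Delta> m)"
    by (rule tensor_map_restrict[OF vs vs vs vsT U subspace_UNIV subspace_UNIV
          linear_on_id linear_on_comult _ _ m, symmetric]) auto
  finally show ?thesis .
qed

lemma counit_restrict:
  "tensor_lift s s U M (\<lambda>x y. s (\<epsilon> x) y) (\<Delta> m) = m"
  "tensor_lift s s U M (\<lambda>x y. s (\<epsilon> y) x) (\<Delta> m) = m"
proof -
  note restrict = tensor_lift_restrict[OF vs vs vs U subspace_UNIV subspace_UNIV _ _ _ m]
  show "tensor_lift s s U M (\<lambda>x y. s (\<epsilon> x) y) (\<Delta> m) = m"
    by (subst restrict) (auto simp: bilinear_on_UNIV_iff linear_simps mult.commute counit_left)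
  show "tensor_lift s s U M (\<lambda>x y. s (\<epsilon> y) x) (\<Delta> m) = m"
    by (subst restrict) (auto simp: bilinear_on_UNIV_iff linear_simps mult.commute counit_right)
qed

end

lemma rota_baxter_identity_restrict:
  assumes "subspace U" "HLR \<subseteq> U" "m \<in> HLR"
  shows "tensor_map s s s s U HLR L L (\<Delta> m) =
    tensor_map s s s s U HLR L id (\<Delta> (L m)) + tensor_map s s s s U HLR id L (\<Delta> (L m)) +
    tensor_scale (-1) (\<Delta> (L m))"
proof -
  have "\<Delta> x \<in> tensor_space s s U HLR" if "x \<in> HLR" for x
    using comult_HLR[OF that] tensor_space_mono[OF assms(2)] by blast
  then have restrict: "tensor_map s s s s U HLR f g (\<Delta> x) = sweedler x (\<lambda>a b. tensor s s (f a) (g b))"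
    if "linear_on s s UNIV UNIV f" "linear_on s s UNIV UNIV g" "x \<in> HLR" for f g x
    \<comment> \<open>The Sweedler sum is folded into a \<open>tensor_map\<close> over the full
      carriers, so that \<open>tensor_map_restrict\<close> applies.\<close>
    unfolding tensor_map_def[of s s s s UNIV UNIV, symmetric]
    by (intro tensor_map_restrict vs assms(1) subspace_UNIV that) (auto simp: that)
  show ?thesis
    using paired_identity_HLR[OF assms(3)]
    by (simp only: restrict linear_on_sqcap_L linear_on_id assms(3) sqcap_L_HLR id_apply)
qed

lemma rota_baxter_paired_comodule_HLR:
  "rota_baxter_paired_comodule s UNIV \<Delta> \<epsilon> s HLR \<Delta> L L (-1)"
proof unfold_locales
  \<comment> \<open>\<open>H\<^sup>LH\<^sup>R \<otimes> H\<^sup>LH\<^sup>R\<close> is literally a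
    subspace of \<open>H \<otimes> H\<^sup>LH\<^sup>R\<close>, so \<open>\<Delta>\<close> itself
    serves as the coaction.\<close>
  have in_UNIV: "\<Delta> m \<in> tensor_space s s UNIV HLR" if "m \<in> HLR" for m
    using comult_HLR[OF that] tensor_space_mono[of HLR UNIV HLR HLR] by blast
  show "subspace HLR" by (rule subspace_HLR)
  show "linear_on s tensor_scale HLR (tensor_space s s UNIV HLR) \<Delta>"
    using in_UNIV by (auto simp: linear_on_def comult_add comult_scale)
  show "linear_on s s UNIV UNIV L" by (rule linear_on_sqcap_L)
  show "linear_on s s HLR HLR L"
    by (auto simp: linear_on_def sqcap_L_linear sqcap_L_HLR)
  fix m assume m: "m \<in> HLR"
  note restrict = subspace_UNIV subspace_HLR in_UNIV[OF m]
  show "tensor_assoc s s s UNIV UNIV HLR (tensor_map s s tensor_scale s UNIV HLR \<Delta> id (\<Delta> m)) =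
      tensor_map s s s tensor_scale UNIV HLR id \<Delta> (\<Delta> m)"
    by (rule coassoc_restrict[OF restrict comult_in])
  show "tensor_lift s s UNIV HLR (\<lambda>x. s (\<epsilon> x)) (\<Delta> m) = m"
    by (rule counit_restrict(1)[OF restrict])
  show "tensor_map s s s s UNIV HLR L L (\<Delta> m) =
      tensor_map s s s s UNIV HLR L id (\<Delta> (L m)) + tensor_map s s s s UNIV HLR id L (\<Delta> (L m)) +
      tensor_scale (-1) (\<Delta> (L m))"
    by (rule rota_baxter_identity_restrict[OF subspace_UNIV subset_UNIV m])
qed

lemma rota_baxter_coalgebra_HLR: "rota_baxter_coalgebra s HLR \<Delta> \<epsilon> L (-1)"
proof unfold_locales
  show "subspace HLR" by (rule subspace_HLR)
  show "linear_on s tensor_scale HLR (tensor_space s s HLR HLR) \<Delta>"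
    using comult_HLR by (auto simp: linear_on_def comult_add comult_scale)
  show "linear_on s (*) HLR UNIV \<epsilon>"
    by (simp add: linear_on_def counit_add counit_scale)
  show "linear_on s s HLR HLR L"
    by (auto simp: linear_on_def sqcap_L_linear sqcap_L_HLR)
  fix m assume m: "m \<in> HLR"
  note restrict = subspace_HLR subspace_HLR comult_HLR[OF m]
  show "tensor_assoc s s s HLR HLR HLR (tensor_map s s tensor_scale s HLR HLR \<Delta> id (\<Delta> m)) =
      tensor_map s s s tensor_scale HLR HLR id \<Delta> (\<Delta> m)"
    by (rule coassoc_restrict[OF restrict comult_HLR])
  show "tensor_lift s s HLR HLR (\<lambda>x. s (\<epsilon> x)) (\<Delta> m) = m"
    by (rule counit_restrict(1)[OF restrict])
  show "tensor_lift s s HLR HLR (\<lambda>x y. s (\<epsilon> y) x) (\<Delta> m) = m"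
    by (rule counit_restrict(2)[OF restrict])
  show "tensor_map s s s s HLR HLR L L (\<Delta> m) =
      tensor_map s s s s HLR HLR L id (\<Delta> (L m)) + tensor_map s s s s HLR HLR id L (\<Delta> (L m)) +
      tensor_scale (-1) (\<Delta> (L m))"
    by (rule rota_baxter_identity_restrict[OF subspace_HLR subset_refl m])
qed

end

theorem proposition4p4:
  fixes s :: "'k::field \<Rightarrow> 'h::{ring, monoid_mult} \<Rightarrow> 'h"
    and \<Delta> :: "'h \<Rightarrow> ('k, 'h, 'h) tensor"
    and \<epsilon> :: "'h \<Rightarrow> 'k"
    and S :: "'h \<Rightarrow> 'h"
  assumes "weak_hopf_algebra s \<Delta> \<epsilon> S"
  shows "rota_baxter_paired_comodule s UNIV \<Delta> \<epsilon> s (base_LR s \<Delta> \<epsilon>) \<Delta>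
           (sqcap_L s \<Delta> \<epsilon>) (sqcap_L s \<Delta> \<epsilon>) (-1)
       \<and> rota_baxter_coalgebra s (base_LR s \<Delta> \<epsilon>) \<Delta> \<epsilon> (sqcap_L s \<Delta> \<epsilon>) (-1)"
proof -
  interpret weak_hopf_algebra s \<Delta> \<epsilon> S by fact
  show ?thesis using rota_baxter_paired_comodule_HLR rota_baxter_coalgebra_HLR by simp
qed

end
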